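(* Let $G$ be a non-abelian group of orientation-preserving $C^2$ diffeomorphisms of $\mathbf{R}$ (a subgroup of $\mathrm{Diff}^2(\mathbf{R})$ all of whose elements preserve orientation) with the property that every nontrivial element of $G$ has at most one fixed point in $\mathbf{R}$. Then there exists $h\in \mathrm{Homeo}(\mathbf{R})$ such that $hGh^{-1}\subseteq \mathrm{Aff}(\mathbf{R})$.
   Context: $\mathrm{Diff}^2(\mathbf{R})$ is the group of $C^2$ diffeomorphisms of the real line $\mathbf{R}$ (bijections that are $C^2$ with $C^2$ inverse). $\mathrm{Homeo}(\mathbf{R})$ is the group of homeomorphisms of $\mathbf{R}$. $\mathrm{Aff}(\mathbf{R})$ is the group of affine maps $x\mapsto ax+b$ of $\mathbf{R}$ with $a,b\in\mathbf{R}$, $a\neq 0$, regarded as a subgroup of $\mathrm{Homeo}(\mathbf{R})$. Here $hGh^{-1}=\{h\circ g\circ h^{-1} : g\in G\}$. *)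

theory Defs
  imports "HOL-Analysis.Analysis" "HOL-Algebra.Group"
begin

text \<open>
  The inverse of a function is written \<open>inv_into UNIV f\<close> rather than \<open>inv f\<close>, since the latter
  notation clashes with the inverse of a group element from HOL-Algebra.
\<close>

definition C2_map :: "(real \<Rightarrow> real) \<Rightarrow> bool" where
  "C2_map f \<longleftrightarrow> f differentiable_on UNIV \<and> deriv f differentiable_on UNIV \<and>
     continuous_on UNIV (deriv (deriv f))"

definition Diff2 :: "(real \<Rightarrow> real) monoid" where
  "Diff2 = \<lparr>carrier = {f. bij f \<and> C2_map f \<and> C2_map (inv_into UNIV f)},
            mult = (\<circ>), one = id\<rparr>"

definition Homeo :: "(real \<Rightarrow> real) set" where
  "Homeo = {h. homeomorphism UNIV UNIV h (inv_into UNIV h)}"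

definition Aff :: "(real \<Rightarrow> real) set" where
  "Aff = {(\<lambda>x. a * x + b) | a b. a \<noteq> 0}"

text \<open>A homeomorphism of the line preserves orientation iff it is increasing.\<close>

definition orientation_preserving :: "(real \<Rightarrow> real) \<Rightarrow> bool" where
  "orientation_preserving f \<longleftrightarrow> strict_mono f"

lemma C2_mapI:
  assumes "\<And>x. (f has_real_derivative f' x) (at x)"
    and "\<And>x. (f' has_real_derivative f'' x) (at x)"
    and "continuous_on UNIV f''"
  shows "C2_map f"
proof -
  have 1: "deriv f = f'" using assms(1) by (auto intro: DERIV_imp_deriv)
  have 2: "deriv f' = f''" using assms(2) by (auto intro: DERIV_imp_deriv)
  show ?thesis
    unfolding C2_map_def 1 2 differentiable_on_def
    using assms real_differentiable_def by blast
qed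

lemma C2_mapD:
  assumes "C2_map f"
  shows "(f has_real_derivative deriv f x) (at x)"
    and "(deriv f has_real_derivative deriv (deriv f) x) (at x)"
    and "continuous_on UNIV (deriv (deriv f))"
  using assms unfolding C2_map_def differentiable_on_def
  by (auto simp: DERIV_deriv_iff_real_differentiable)

lemma C2_map_comp:
  assumes f: "C2_map f" and g: "C2_map g"
  shows "C2_map (f \<circ> g)"
proof (rule C2_mapI)
  let ?d = "\<lambda>x. deriv f (g x) * deriv g x"
  let ?e = "\<lambda>x. deriv (deriv f) (g x) * deriv g x * deriv g x + deriv (deriv g) x * deriv f (g x)"
  show "(f \<circ> g has_real_derivative ?d x) (at x)" for x
    by (rule DERIV_chain[OF C2_mapD(1)[OF f] C2_mapD(1)[OF g]])
  show "(?d has_real_derivative ?e x) (at x)" for x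
    by (rule DERIV_mult[OF DERIV_chain2[OF C2_mapD(2)[OF f] C2_mapD(1)[OF g]] C2_mapD(2)[OF g]])
  have "continuous_on UNIV g" "continuous_on UNIV (deriv g)" "continuous_on UNIV (deriv f)"
    using C2_mapD(1,2)[OF f] C2_mapD(1,2)[OF g]
    by (auto intro!: DERIV_continuous_on intro: has_field_derivative_at_within)
  then show "continuous_on UNIV ?e"
    using C2_mapD(3)[OF f] C2_mapD(3)[OF g]
    by (intro continuous_intros) (auto intro: continuous_on_compose2)
qed

lemma C2_map_id: "C2_map id"
  by (rule C2_mapI[where f' = "\<lambda>_. 1" and f'' = "\<lambda>_. 0"]) (auto simp: id_def)

lemma group_Diff2: "group Diff2"
proof (rule groupI)
  fix f g assume "f \<in> carrier Diff2" "g \<in> carrier Diff2"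
  then show "f \<otimes>\<^bsub>Diff2\<^esub> g \<in> carrier Diff2"
    by (auto simp: Diff2_def bij_comp C2_map_comp o_inv_distrib)
next
  show "\<one>\<^bsub>Diff2\<^esub> \<in> carrier Diff2"
    by (auto simp: Diff2_def C2_map_id)
next
  fix f assume "f \<in> carrier Diff2"
  then show "\<exists>g\<in>carrier Diff2. g \<otimes>\<^bsub>Diff2\<^esub> f = \<one>\<^bsub>Diff2\<^esub>"
    by (intro bexI[of _ "inv_into UNIV f"])
      (auto simp: Diff2_def bij_imp_bij_inv inv_inv_eq bij_is_inj)
qed (auto simp: Diff2_def)

lemma Aff_subset_Homeo: "Aff \<subseteq> Homeo"
proof
  fix f assume "f \<in> Aff"
  then obtain a b where a: "a \<noteq> 0" and f: "f = (\<lambda>x. a * x + b)"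
    by (auto simp: Aff_def)
  have "inv_into UNIV f = (\<lambda>y. (y - b) / a)"
    using a by (intro inv_equality) (auto simp: f)
  then show "f \<in> Homeo"
    using a by (auto simp: Homeo_def f intro!: homeomorphismI continuous_intros)
qed

end

theory Submission
  imports Defs
begin

text \<open>
  Comparing germs at \<open>+\<infinity>\<close> turns \<open>G\<close> into a bi-ordered group, because two distinct elements
  agree in at most one point. A bi-ordered group with an element \<open>h\<close> whose powers eventually exceed
  everything carries a unique monotone homomorphism to the reals with value \<open>1\<close> at \<open>h\<close>; in particular
  an Archimedean group is commutative (\<open>hoelder_exists\<close>, \<open>archimedean_commute\<close>). If the nontrivial elements of \<open>G\<close> had no fixed points
  on some ray \<open>[x, \<infinity>)\<close>, then \<open>G\<close> would be Archimedean. So some nontrivial element has a fixed point,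
  and no point is fixed by all of \<open>G\<close>.

  Moving a fixed point by the group excludes parabolic elements (\<open>no_parabolic\<close>), so a nontrivial element with a fixed
  point, or its inverse, is expanding. The powers of an expanding element exceed every element of \<open>G\<close>
  near \<open>+\<infinity>\<close> (\<open>expanding_dominating\<close>). The corresponding homomorphism \<open>\<tau>\<close> is therefore nonzero on all nontrivial elements
  with a fixed point: its kernel \<open>T\<close> is a normal subgroup acting freely, and it is nontrivial since it
  contains the commutators (\<open>exists_free_normal_subgroup\<close>). Hoelder's theorem for \<open>T\<close> gives an injective homomorphism
  \<open>\<phi> : T \<rightarrow> \<real>\<close>, and by uniqueness of \<open>\<phi>\<close> conjugation by \<open>g\<close> multiplies \<open>\<phi>\<close> by a positive constant.
  For an expanding \<open>e\<close> with fixed point \<open>q\<close> this constant exceeds \<open>1\<close>, so \<open>\<phi>\<close> has dense image. The map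
  sending the orbit point \<open>t q\<close> to \<open>\<phi> t\<close> then extends to a monotone surjection of the line which
  carries every element of \<open>G\<close> to an affine map (\<open>semiconj_surj\<close>, \<open>semiconj_affine\<close>).

  Only injectivity of this surjection uses smoothness; homeomorphisms could have wandering intervals.
  Suppose that it collapses a maximal interval \<open>[a, b]\<close> to a point. Normalise the unit of \<open>\<phi>\<close>, and
  iterate \<open>e\<close>, returning to a fixed compact interval by an integer translation after each step; on the
  affine side this is the expanding map \<open>x \<mapsto> r x mod 1\<close>. The images of \<open>[a, b]\<close> are pairwise disjoint because
  a nontrivial element cannot fix both end points of an interval, so their lengths are summable and the
  distortion of the iterates is bounded, as in the theorems of Denjoy and Schwartz (\<open>denjoy_schwartz\<close>). The bound persists
  on a strictly larger interval \<open>[a - \<delta>, b]\<close>, whose images therefore stay bounded. But this larger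
  interval has an image of positive length, which the affine action stretches without bound.
\<close>

section \<open>Hoelder's theorem for bi-ordered groups\<close>

locale biordered_group = group G for G (structure) +
  fixes le :: "'a \<Rightarrow> 'a \<Rightarrow> bool" (infix "\<preceq>" 50)
  assumes le_total: "x \<in> carrier G \<Longrightarrow> y \<in> carrier G \<Longrightarrow> x \<preceq> y \<or> y \<preceq> x"
    and le_trans: "x \<in> carrier G \<Longrightarrow> y \<in> carrier G \<Longrightarrow> z \<in> carrier G \<Longrightarrow>
      x \<preceq> y \<Longrightarrow> y \<preceq> z \<Longrightarrow> x \<preceq> z"
    and le_antisym: "x \<in> carrier G \<Longrightarrow> y \<in> carrier G \<Longrightarrow> x \<preceq> y \<Longrightarrow> y \<preceq> x \<Longrightarrow> x = y"
    and le_mult_left: "x \<in> carrier G \<Longrightarrow> y \<in> carrier G \<Longrightarrow> z \<in> carrier G \<Longrightarrow>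
      x \<preceq> y \<Longrightarrow> z \<otimes> x \<preceq> z \<otimes> y"
    and le_mult_right: "x \<in> carrier G \<Longrightarrow> y \<in> carrier G \<Longrightarrow> z \<in> carrier G \<Longrightarrow>
      x \<preceq> y \<Longrightarrow> x \<otimes> z \<preceq> y \<otimes> z"
begin

lemma le_refl: "x \<in> carrier G \<Longrightarrow> x \<preceq> x"
  using le_total by blast

lemma le_mult:
  assumes "x \<in> carrier G" "y \<in> carrier G" "z \<in> carrier G" "w \<in> carrier G" "x \<preceq> y" "z \<preceq> w"
  shows "x \<otimes> z \<preceq> y \<otimes> w"
  by (rule le_trans[of _ "y \<otimes> z"]) (use assms le_mult_left le_mult_right in auto)

text \<open>
  Domination of the powers of \<open>h\<close> over the whole group is the part of the Archimedean property that
  concerns \<open>h\<close>. A group can contain dominating elements without being Archimedean, and this is used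
  below: expanding homeomorphisms dominate, translations need not.
\<close>

definition dominating :: "'a \<Rightarrow> bool" where
  "dominating h \<longleftrightarrow> h \<in> carrier G \<and> \<one> \<preceq> h \<and> h \<noteq> \<one> \<and> (\<forall>g\<in>carrier G. \<exists>n::nat. g \<preceq> h [^] n)"

definition monotone_hom :: "('a \<Rightarrow> real) \<Rightarrow> bool" where
  "monotone_hom \<tau> \<longleftrightarrow> (\<forall>x\<in>carrier G. \<forall>y\<in>carrier G. \<tau> (x \<otimes> y) = \<tau> x + \<tau> y) \<and>
     (\<forall>x\<in>carrier G. \<forall>y\<in>carrier G. x \<preceq> y \<longrightarrow> \<tau> x \<le> \<tau> y)"

lemma monotone_hom_mult:
  "monotone_hom \<tau> \<Longrightarrow> x \<in> carrier G \<Longrightarrow> y \<in> carrier G \<Longrightarrow> \<tau> (x \<otimes> y) = \<tau> x + \<tau> y"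
  and monotone_hom_le:
  "monotone_hom \<tau> \<Longrightarrow> x \<in> carrier G \<Longrightarrow> y \<in> carrier G \<Longrightarrow> x \<preceq> y \<Longrightarrow> \<tau> x \<le> \<tau> y"
  by (auto simp: monotone_hom_def)

lemma monotone_hom_one: "monotone_hom \<tau> \<Longrightarrow> \<tau> \<one> = 0"
  using monotone_hom_mult[of \<tau> \<one> \<one>] by simp

lemma monotone_hom_inv: "monotone_hom \<tau> \<Longrightarrow> x \<in> carrier G \<Longrightarrow> \<tau> (inv x) = - \<tau> x"
  using monotone_hom_mult[of \<tau> x "inv x"] monotone_hom_one[of \<tau>] by simp

lemma monotone_hom_pow: "monotone_hom \<tau> \<Longrightarrow> x \<in> carrier G \<Longrightarrow> \<tau> (x [^] (n::nat)) = n * \<tau> x"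
  by (induction n) (auto simp: monotone_hom_one monotone_hom_mult algebra_simps)

lemma monotone_hom_int_pow:
  assumes \<tau>: "monotone_hom \<tau>" and x: "x \<in> carrier G"
  shows "\<tau> (x [^] (n::int)) = n * \<tau> x"
proof (cases "0 \<le> n")
  case True
  then show ?thesis using monotone_hom_pow[OF \<tau> x, of "nat n"] by (simp add: pow_nat)
next
  case False
  then have "x [^] n = inv (x [^] nat (- n))" using x int_pow_neg[of x "- n"] pow_nat[of "- n" G x] by simp
  then show ?thesis using \<tau> x False monotone_hom_pow[OF \<tau> x, of "nat (- n)"] by (simp add: monotone_hom_inv)
qed

lemma nat_pow_mono:
  assumes "x \<in> carrier G" "y \<in> carrier G" "x \<preceq> y"
  shows "x [^] (n::nat) \<preceq> y [^] n"
  by (induction n) (use assms in \<open>auto simp: le_refl intro: le_mult\<close>)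

lemma one_le_pow:
  assumes "h \<in> carrier G" "\<one> \<preceq> h"
  shows "\<one> \<preceq> h [^] (n::nat)"
  using nat_pow_mono[of \<one> h n] assms by simp

lemma int_pow_le:
  assumes h: "h \<in> carrier G" "\<one> \<preceq> h" and "m \<le> (n::int)"
  shows "h [^] m \<preceq> h [^] n"
proof -
  have "h [^] m \<otimes> \<one> \<preceq> h [^] m \<otimes> h [^] nat (n - m)"
    using h by (intro le_mult_left one_le_pow) auto
  also have "h [^] m \<otimes> h [^] nat (n - m) = h [^] n"
    using h assms(3) by (simp add: int_pow_mult[symmetric] pow_nat)
  finally show ?thesis using h by simp
qed

lemma int_pow_less:
  assumes h: "h \<in> carrier G" "\<one> \<preceq> h" and g: "g \<in> carrier G"
    and "h [^] (m::int) \<preceq> g" "\<not> h [^] (n::int) \<preceq> g"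
  shows "m < n"
proof (rule ccontr)
  assume "\<not> m < n"
  then have "h [^] n \<preceq> h [^] m" using int_pow_le[OF h] by simp
  then show False using assms le_trans[of "h [^] n" "h [^] m" g] by auto
qed

lemma le_inv_swap:
  assumes "x \<in> carrier G" "y \<in> carrier G" "x \<preceq> y"
  shows "inv y \<preceq> inv x"
proof -
  have "inv y \<otimes> x \<otimes> inv x \<preceq> inv y \<otimes> y \<otimes> inv x"
    using assms by (intro le_mult_right le_mult_left) auto
  then show ?thesis using assms by (simp add: m_assoc)
qed

lemma le_cancel_left:
  assumes "x \<in> carrier G" "y \<in> carrier G" "z \<in> carrier G" "z \<otimes> x \<preceq> z \<otimes> y"
  shows "x \<preceq> y"
  using le_mult_left[of "z \<otimes> x" "z \<otimes> y" "inv z"] assms by (simp add: m_assoc[symmetric])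

lemma int_pow_not_le:
  assumes h: "h \<in> carrier G" "\<one> \<preceq> h" "h \<noteq> \<one>"
  shows "\<not> h [^] (n + 1 :: int) \<preceq> h [^] n"
proof
  assume "h [^] (n + 1) \<preceq> h [^] n"
  then have "h [^] n \<otimes> h \<preceq> h [^] n \<otimes> \<one>" using h by (simp add: int_pow_mult)
  then have "h \<preceq> \<one>" using h le_cancel_left[of h \<one> "h [^] n"] by simp
  then show False using h le_antisym by auto
qed

text \<open>
  The integer \<open>m\<close> is the integer part of \<open>g\<close> measured in units of \<open>h\<close>.
\<close>

lemma integer_part_exists:
  assumes dom: "dominating h" and g: "g \<in> carrier G"
  shows "\<exists>m::int. h [^] m \<preceq> g \<and> \<not> h [^] (m + 1) \<preceq> g"
proof -
  have h: "h \<in> carrier G" "\<one> \<preceq> h" "h \<noteq> \<one>" using dom by (auto simp: dominating_def)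
  obtain n where n: "g \<preceq> h [^] (n::nat)" using dom g by (auto simp: dominating_def)
  obtain k where k: "inv g \<preceq> h [^] (k::nat)" using dom g by (auto simp: dominating_def)
  have low: "h [^] (- int k) \<preceq> g"
    using le_inv_swap[OF _ _ k] g h by (simp add: int_pow_neg int_pow_int)
  have high: "\<not> h [^] (int n + 1) \<preceq> g"
    using int_pow_not_le[OF h, of "int n"] n le_trans[of "h [^] (int n + 1)" g "h [^] n"] h g
    by (auto simp: int_pow_int)
  let ?S = "{m::int. - int k \<le> m \<and> h [^] m \<preceq> g}"
  have "?S \<subseteq> {- int k..int n}"
    using int_pow_less[OF h(1,2) g _ high] by force
  then have fin: "finite ?S" by (rule finite_subset) simp
  have ne: "?S \<noteq> {}" using low by blast
  have "Max ?S \<in> ?S" using fin ne by (rule Max_in)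
  moreover have "\<not> h [^] (Max ?S + 1) \<preceq> g"
  proof
    assume "h [^] (Max ?S + 1) \<preceq> g"
    then have "Max ?S + 1 \<in> ?S" using \<open>Max ?S \<in> ?S\<close> by auto
    then show False using Max_ge[OF fin] by fastforce
  qed
  ultimately show ?thesis by blast
qed

lemma pow_commute_le:
  assumes "x \<in> carrier G" "y \<in> carrier G" "y \<otimes> x \<preceq> x \<otimes> y"
  shows "y [^] (n::nat) \<otimes> x \<preceq> x \<otimes> y [^] n" "y \<otimes> x [^] (n::nat) \<preceq> x [^] n \<otimes> y"
proof -
  show "y [^] n \<otimes> x \<preceq> x \<otimes> y [^] n"
  proof (induction n)
    case 0 then show ?case using assms by (simp add: le_refl)
  next
    case (Suc n)
    have "y [^] n \<otimes> (y \<otimes> x) \<preceq> y [^] n \<otimes> (x \<otimes> y)" using assms by (intro le_mult_left) auto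
    moreover have "(y [^] n \<otimes> x) \<otimes> y \<preceq> (x \<otimes> y [^] n) \<otimes> y"
      using assms Suc by (intro le_mult_right) auto
    ultimately have "y [^] n \<otimes> (y \<otimes> x) \<preceq> (x \<otimes> y [^] n) \<otimes> y"
      using assms le_trans[of "y [^] n \<otimes> (y \<otimes> x)" "y [^] n \<otimes> (x \<otimes> y)"] by (simp add: m_assoc)
    then show ?case using assms by (simp add: m_assoc)
  qed
  show "y \<otimes> x [^] n \<preceq> x [^] n \<otimes> y"
  proof (induction n)
    case 0 then show ?case using assms by (simp add: le_refl)
  next
    case (Suc n)
    have "(y \<otimes> x [^] n) \<otimes> x \<preceq> (x [^] n \<otimes> y) \<otimes> x" using assms Suc by (intro le_mult_right) auto
    moreover have "x [^] n \<otimes> (y \<otimes> x) \<preceq> x [^] n \<otimes> (x \<otimes> y)"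
      using assms by (intro le_mult_left) auto
    ultimately have "(y \<otimes> x [^] n) \<otimes> x \<preceq> x [^] n \<otimes> (x \<otimes> y)"
      using assms le_trans[of "(y \<otimes> x [^] n) \<otimes> x" "(x [^] n \<otimes> y) \<otimes> x"] by (simp add: m_assoc)
    then show ?case using assms by (simp add: m_assoc)
  qed
qed

text \<open>
  Replaces commutativity: the order allows \<open>(x y)\<^sup>n\<close> to be compared with \<open>x\<^sup>n y\<^sup>n\<close>, by moving all factors
  \<open>y\<close> past the factors \<open>x\<close>, each exchange going in the same direction of the order.
\<close>

lemma pow_mult_between:
  assumes c: "x \<in> carrier G" "y \<in> carrier G" and le: "y \<otimes> x \<preceq> x \<otimes> y"
  shows "y [^] (n::nat) \<otimes> x [^] n \<preceq> (y \<otimes> x) [^] n" "(x \<otimes> y) [^] n \<preceq> x [^] n \<otimes> y [^] n"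
proof -
  note comm = pow_commute_le[OF c le]
  show "(x \<otimes> y) [^] n \<preceq> x [^] n \<otimes> y [^] n"
  proof (induction n)
    case 0 then show ?case by (simp add: le_refl)
  next
    case (Suc n)
    have "(x \<otimes> y) [^] n \<otimes> (x \<otimes> y) \<preceq> (x [^] n \<otimes> y [^] n) \<otimes> (x \<otimes> y)"
      using c Suc by (intro le_mult_right) auto
    moreover have "x [^] n \<otimes> ((y [^] n \<otimes> x) \<otimes> y) \<preceq> x [^] n \<otimes> ((x \<otimes> y [^] n) \<otimes> y)"
      using c comm by (intro le_mult_left le_mult_right) auto
    ultimately show ?case
      using c le_trans[of "(x \<otimes> y) [^] n \<otimes> (x \<otimes> y)" "(x [^] n \<otimes> y [^] n) \<otimes> (x \<otimes> y)"]
      by (simp add: m_assoc)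
  qed
  show "y [^] n \<otimes> x [^] n \<preceq> (y \<otimes> x) [^] n"
  proof (induction n)
    case 0 then show ?case by (simp add: le_refl)
  next
    case (Suc n)
    have "y [^] n \<otimes> ((y \<otimes> x [^] n) \<otimes> x) \<preceq> y [^] n \<otimes> ((x [^] n \<otimes> y) \<otimes> x)"
      using c comm by (intro le_mult_left le_mult_right) auto
    moreover have "(y [^] n \<otimes> x [^] n) \<otimes> (y \<otimes> x) \<preceq> (y \<otimes> x) [^] n \<otimes> (y \<otimes> x)"
      using c Suc by (intro le_mult_right) auto
    ultimately show ?case
      using c le_trans[of "y [^] n \<otimes> ((y \<otimes> x [^] n) \<otimes> x)" "y [^] n \<otimes> ((x [^] n \<otimes> y) \<otimes> x)"]
      by (simp add: m_assoc)
  qed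
qed

text \<open>
  The integer part \<open>F\<close> is a homomorphism up to an error of \<open>1\<close>, so \<open>F (g\<^sup>N) / N\<close> converges along the
  powers \<open>N = 2\<^sup>n\<close>. The limit is additive because \<open>(x y)\<^sup>N\<close> lies between the two products of \<open>x\<^sup>N\<close> and
  \<open>y\<^sup>N\<close>, whose integer parts differ from the sum of the integer parts by at most \<open>1\<close>.
\<close>

theorem hoelder_exists:
  assumes dom: "dominating h"
  obtains \<tau> where "monotone_hom \<tau>" "\<tau> h = 1"
proof -
  have h: "h \<in> carrier G" "\<one> \<preceq> h" "h \<noteq> \<one>" using dom by (auto simp: dominating_def)
  obtain F :: "'a \<Rightarrow> int" where
    F: "\<And>g. g \<in> carrier G \<Longrightarrow> h [^] F g \<preceq> g \<and> \<not> h [^] (F g + 1) \<preceq> g"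
    using integer_part_exists[OF dom] by metis
  have F_ge: "n \<le> F g" if "g \<in> carrier G" "h [^] n \<preceq> g" for g n
    using int_pow_less[OF h(1,2) that] F[OF that(1)] by fastforce
  have F_mono: "F x \<le> F y" if "x \<in> carrier G" "y \<in> carrier G" "x \<preceq> y" for x y
    using F_ge[of y "F x"] F[of x] le_trans[of "h [^] F x" x y] that h by auto
  have F_super: "F x + F y \<le> F (x \<otimes> y)" if "x \<in> carrier G" "y \<in> carrier G" for x y
    using that F[of x] F[of y] h by (intro F_ge) (auto simp: int_pow_mult intro!: le_mult)
  have F_int_pow: "F (h [^] n) = n" for n :: int
  proof (rule antisym)
    show "n \<le> F (h [^] n)" by (rule F_ge) (use h le_refl in auto)
    have "\<not> h [^] (n + 1) \<preceq> h [^] n" using h int_pow_not_le by simp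
    then show "F (h [^] n) \<le> n"
      using int_pow_less[OF h(1,2), of "h [^] n" "F (h [^] n)" "n + 1"] F[of "h [^] n"] h by simp
  qed
  have F_sub: "F (x \<otimes> y) \<le> F x + F y + 1" if c: "x \<in> carrier G" "y \<in> carrier G" for x y
  proof -
    have x: "x \<preceq> h [^] (F x + 1)" and y: "y \<preceq> h [^] (F y + 1)"
      using F[of x] F[of y] le_total c h by blast+
    have "\<not> h [^] (F x + 1) \<otimes> h [^] (F y + 1) \<preceq> x \<otimes> y"
    proof
      assume "h [^] (F x + 1) \<otimes> h [^] (F y + 1) \<preceq> x \<otimes> y"
      moreover have "x \<otimes> y \<preceq> h [^] (F x + 1) \<otimes> y"
        using x c h by (auto intro: le_mult_right)
      ultimately have "h [^] (F x + 1) \<otimes> h [^] (F y + 1) \<preceq> h [^] (F x + 1) \<otimes> y"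
        using le_trans[of "h [^] (F x + 1) \<otimes> h [^] (F y + 1)" "x \<otimes> y" "h [^] (F x + 1) \<otimes> y"] c h
        by auto
      then have "h [^] (F y + 1) \<preceq> y" using c h le_cancel_left[of "h [^] (F y + 1)" y] by blast
      then show False using F[of y] c by blast
    qed
    moreover have "h [^] (F x + 1) \<otimes> h [^] (F y + 1) = h [^] (F x + F y + 2)"
      using int_pow_mult[OF h(1), of "F x + 1" "F y + 1"] by (simp add: algebra_simps)
    ultimately have "\<not> h [^] (F x + F y + 2) \<preceq> x \<otimes> y" by simp
    then show ?thesis
      using int_pow_less[OF h(1,2), of "x \<otimes> y" "F (x \<otimes> y)" "F x + F y + 2"] F[of "x \<otimes> y"] c by simp
  qed
  have F_pow_mult: "\<bar>F ((x \<otimes> y) [^] n) - F (x [^] n) - F (y [^] n)\<bar> \<le> 1"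
    if c: "x \<in> carrier G" "y \<in> carrier G" for x y and n :: nat
  proof (cases "y \<otimes> x \<preceq> x \<otimes> y")
    case True
    then show ?thesis
      using pow_mult_between[OF c True, of n] nat_pow_mono[OF _ _ True, of n]
        F_super[of "y [^] n" "x [^] n"] F_sub[of "x [^] n" "y [^] n"]
        F_mono[of "y [^] n \<otimes> x [^] n" "(y \<otimes> x) [^] n"] F_mono[of "(y \<otimes> x) [^] n" "(x \<otimes> y) [^] n"]
        F_mono[of "(x \<otimes> y) [^] n" "x [^] n \<otimes> y [^] n"] c
      by simp
  next
    case False
    then have le: "x \<otimes> y \<preceq> y \<otimes> x" using c le_total by blast
    then show ?thesis
      using pow_mult_between[OF c(2,1) le, of n] nat_pow_mono[OF _ _ le, of n]
        F_super[of "x [^] n" "y [^] n"] F_sub[of "y [^] n" "x [^] n"]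
        F_mono[of "x [^] n \<otimes> y [^] n" "(x \<otimes> y) [^] n"] F_mono[of "(x \<otimes> y) [^] n" "(y \<otimes> x) [^] n"]
        F_mono[of "(y \<otimes> x) [^] n" "y [^] n \<otimes> x [^] n"] c
      by simp
  qed
  define a where "a g n = real_of_int (F (g [^] (2 ^ n :: nat))) / 2 ^ n" for g n
  have conv: "convergent (a g)" if g: "g \<in> carrier G" for g
  proof -
    have dbl: "g [^] (2 ^ Suc n :: nat) = g [^] (2 ^ n :: nat) \<otimes> g [^] (2 ^ n :: nat)" for n
      using g by (simp add: nat_pow_mult mult_2)
    have inc: "a g n \<le> a g (Suc n)" for n
    proof -
      have "F (g [^] (2 ^ n :: nat)) + F (g [^] (2 ^ n :: nat)) \<le> F (g [^] (2 ^ Suc n :: nat))"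
        unfolding dbl using F_super[of "g [^] (2 ^ n :: nat)" "g [^] (2 ^ n :: nat)"] g by simp
      then have "2 * real_of_int (F (g [^] (2 ^ n :: nat))) \<le> F (g [^] (2 ^ Suc n :: nat))"
        by linarith
      then show ?thesis by (simp add: a_def field_simps)
    qed
    have dec: "a g (Suc n) + 1 / 2 ^ Suc n \<le> a g n + 1 / 2 ^ n" for n
    proof -
      have "F (g [^] (2 ^ Suc n :: nat)) \<le> F (g [^] (2 ^ n :: nat)) + F (g [^] (2 ^ n :: nat)) + 1"
        unfolding dbl using F_sub[of "g [^] (2 ^ n :: nat)" "g [^] (2 ^ n :: nat)"] g by simp
      then have "F (g [^] (2 ^ Suc n :: nat)) \<le> 2 * real_of_int (F (g [^] (2 ^ n :: nat))) + 1"
        by linarith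
      then have "(F (g [^] (2 ^ Suc n :: nat)) + 1) / 2 ^ Suc n
          \<le> (2 * real_of_int (F (g [^] (2 ^ n :: nat))) + 2) / 2 ^ Suc n"
        by (intro divide_right_mono) auto
      then show ?thesis by (simp add: a_def add_divide_distrib)
    qed
    have "a g n + 1 / 2 ^ n \<le> a g 0 + 1" for n
    proof (induction n)
      case (Suc n) then show ?case using dec[of n] by linarith
    qed simp
    moreover have "0 \<le> (1::real) / 2 ^ n" for n by simp
    ultimately have "a g n \<le> a g 0 + 1" for n by (smt (verit))
    moreover have "incseq (a g)" using inc by (rule incseq_SucI)
    ultimately show ?thesis by (metis incseq_convergent convergentI)
  qed
  define \<tau> where "\<tau> g = lim (a g)" for g
  have lim: "a g \<longlonglongrightarrow> \<tau> g" if "g \<in> carrier G" for g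
    using conv[OF that] by (simp add: \<tau>_def convergent_LIMSEQ_iff)
  have "\<tau> (x \<otimes> y) = \<tau> x + \<tau> y" if c: "x \<in> carrier G" "y \<in> carrier G" for x y
  proof -
    have "(\<lambda>n. a (x \<otimes> y) n - a x n - a y n) \<longlonglongrightarrow> \<tau> (x \<otimes> y) - \<tau> x - \<tau> y"
      using c by (intro tendsto_intros lim) auto
    moreover have "(\<lambda>n. a (x \<otimes> y) n - a x n - a y n) \<longlonglongrightarrow> 0"
    proof (rule Lim_null_comparison)
      have "\<bar>a (x \<otimes> y) n - a x n - a y n\<bar> \<le> 1 / 2 ^ n" for n
      proof -
        have "a (x \<otimes> y) n - a x n - a y n = (F ((x \<otimes> y) [^] (2 ^ n :: nat)) - F (x [^] (2 ^ n :: nat))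
          - F (y [^] (2 ^ n :: nat))) / 2 ^ n"
          by (simp add: a_def diff_divide_distrib)
        then show ?thesis using F_pow_mult[OF c, of "2 ^ n"] by (simp add: divide_right_mono abs_divide)
      qed
      then show "\<forall>\<^sub>F n in sequentially. norm (a (x \<otimes> y) n - a x n - a y n) \<le> 1 / 2 ^ n" by simp
      show "(\<lambda>n. 1 / 2 ^ n :: real) \<longlonglongrightarrow> 0"
        using LIMSEQ_inverse_realpow_zero[of 2] by (simp add: divide_inverse)
    qed
    ultimately have "\<tau> (x \<otimes> y) - \<tau> x - \<tau> y = 0" by (rule LIMSEQ_unique)
    then show ?thesis by simp
  qed
  moreover have "\<tau> x \<le> \<tau> y" if c: "x \<in> carrier G" "y \<in> carrier G" "x \<preceq> y" for x y
    by (rule LIMSEQ_le[OF lim lim])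
      (use c F_mono nat_pow_mono in \<open>auto simp: a_def divide_right_mono\<close>)
  ultimately have hom: "monotone_hom \<tau>" by (auto simp: monotone_hom_def)
  have "a h = (\<lambda>_. 1)" using F_int_pow[of "2 ^ n" for n] h by (auto simp: a_def int_pow_int[symmetric])
  then have "\<tau> h = 1" using lim[OF h(1)] by (simp add: LIMSEQ_const_iff)
  then show ?thesis using hom that by blast
qed

text \<open>
  Both \<open>\<psi>\<close> and \<open>\<psi> h \<cdot> \<tau>\<close> are determined by the integer part up to an error of \<open>\<psi> h\<close>, so their difference
  is a bounded homomorphism to the reals and hence vanishes.
\<close>

theorem hoelder_unique:
  assumes dom: "dominating h" and \<tau>: "monotone_hom \<tau>" "\<tau> h = 1" and \<psi>: "monotone_hom \<psi>"
    and g: "g \<in> carrier G"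
  shows "\<psi> g = \<psi> h * \<tau> g"
proof -
  have h: "h \<in> carrier G" "\<one> \<preceq> h" "h \<noteq> \<one>" using dom by (auto simp: dominating_def)
  have pos: "0 \<le> \<psi> h" using monotone_hom_le[OF \<psi>, of \<one> h] h \<psi> by (simp add: monotone_hom_one)
  have bdd: "\<bar>\<psi> x - \<psi> h * \<tau> x\<bar> \<le> \<psi> h" if x: "x \<in> carrier G" for x
  proof -
    obtain m :: int where m: "h [^] m \<preceq> x" "\<not> h [^] (m + 1) \<preceq> x"
      using integer_part_exists[OF dom x] by blast
    then have up: "x \<preceq> h [^] (m + 1)" using le_total[of x "h [^] (m + 1)"] x h by auto
    have "m \<le> \<tau> x" "\<tau> x \<le> m + 1"
      using monotone_hom_le[OF \<tau>(1) _ _ m(1)] monotone_hom_le[OF \<tau>(1) _ _ up] x h \<tau>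
      by (auto simp: monotone_hom_int_pow)
    then have "\<psi> h * m \<le> \<psi> h * \<tau> x" "\<psi> h * \<tau> x \<le> \<psi> h * (m + 1)"
      using pos by (auto intro: mult_left_mono)
    moreover have "m * \<psi> h \<le> \<psi> x" "\<psi> x \<le> (m + 1) * \<psi> h"
      using monotone_hom_le[OF \<psi> _ _ m(1)] monotone_hom_le[OF \<psi> _ _ up] x h \<psi>
      by (auto simp: monotone_hom_int_pow)
    ultimately show ?thesis by (simp add: algebra_simps abs_le_iff)
  qed
  have "n * \<bar>\<psi> g - \<psi> h * \<tau> g\<bar> \<le> \<psi> h" for n :: nat
  proof -
    have "n * \<bar>\<psi> g - \<psi> h * \<tau> g\<bar> = \<bar>n * (\<psi> g - \<psi> h * \<tau> g)\<bar>" by (simp add: abs_mult)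
    also have "\<dots> = \<bar>\<psi> (g [^] n) - \<psi> h * \<tau> (g [^] n)\<bar>"
      using \<tau> \<psi> g by (simp add: monotone_hom_pow algebra_simps)
    finally show ?thesis using bdd[of "g [^] n"] g by simp
  qed
  then have "\<bar>\<psi> g - \<psi> h * \<tau> g\<bar> = 0"
    using reals_Archimedean3[of "\<bar>\<psi> g - \<psi> h * \<tau> g\<bar>"] by (metis abs_ge_zero abs_of_nonneg less_eq_real_def not_le)
  then show ?thesis by simp
qed

text \<open>
  Homomorphisms to the reals kill commutators, but a nontrivial commutator or its inverse would be
  positive, hence dominating, and some homomorphism takes the value \<open>1\<close> on it.
\<close>

theorem archimedean_commute:
  assumes arch: "\<And>h. h \<in> carrier G \<Longrightarrow> \<one> \<preceq> h \<Longrightarrow> h \<noteq> \<one> \<Longrightarrow> dominating h"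
    and c: "x \<in> carrier G" "y \<in> carrier G"
  shows "x \<otimes> y = y \<otimes> x"
proof (rule ccontr)
  assume ne: "x \<otimes> y \<noteq> y \<otimes> x"
  define k where "k = (x \<otimes> y) \<otimes> inv (y \<otimes> x)"
  have k: "k \<in> carrier G" and "k \<noteq> \<one>"
    using c ne unfolding k_def by (auto dest!: inv_equality simp del: inv_mult_group)
  then have ink: "inv k \<noteq> \<one>" by (metis inv_inv inv_one)
  have zero: "\<tau> k = 0 \<and> \<tau> (inv k) = 0" if "monotone_hom \<tau>" for \<tau>
    using that c k by (simp add: k_def monotone_hom_mult monotone_hom_inv)
  have "\<one> \<preceq> k \<or> \<one> \<preceq> inv k"
    using le_total[OF one_closed k] le_inv_swap[OF k one_closed] by auto
  then obtain h where h: "h = k \<or> h = inv k" "\<one> \<preceq> h" "h \<noteq> \<one>"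
    using ink \<open>k \<noteq> \<one>\<close> by blast
  have "h \<in> carrier G" using h(1) k by auto
  then obtain \<tau> where \<tau>: "monotone_hom \<tau>" "\<tau> h = 1"
    using hoelder_exists[OF arch[OF _ h(2,3)]] by blast
  then show False using zero[OF \<tau>(1)] h(1) by auto
qed

end

section \<open>Groups of homeomorphisms of the line\<close>

abbreviation inverse_map :: "(real \<Rightarrow> real) \<Rightarrow> real \<Rightarrow> real" where
  "inverse_map f \<equiv> inv_into UNIV f"

definition composition_monoid :: "(real \<Rightarrow> real) set \<Rightarrow> (real \<Rightarrow> real) monoid" where
  "composition_monoid G = \<lparr>carrier = G, mult = (\<circ>), one = id\<rparr>"

lemma composition_monoid_simps [simp]:
  "carrier (composition_monoid G) = G"
  "f \<otimes>\<^bsub>composition_monoid G\<^esub> g = f \<circ> g"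
  "\<one>\<^bsub>composition_monoid G\<^esub> = id"
  by (simp_all add: composition_monoid_def)

lemma composition_monoid_pow [simp]: "f [^]\<^bsub>composition_monoid G\<^esub> (n::nat) = f ^^ n"
  by (induction n) (simp_all add: nat_pow_def funpow_Suc_right del: funpow.simps)

text \<open>
  The order of germs at \<open>+\<infinity>\<close>.
\<close>

definition germ_le :: "(real \<Rightarrow> real) \<Rightarrow> (real \<Rightarrow> real) \<Rightarrow> bool" where
  "germ_le f g \<longleftrightarrow> (\<forall>\<^sub>F x in at_top. f x \<le> g x)"

lemma mono_surj_continuous:
  fixes f :: "real \<Rightarrow> real"
  assumes "mono f" "surj f"
  shows "continuous_on UNIV f"
  using assms by (intro continuous_onI_mono) (auto dest: monoD)

lemma fixed_point_between:
  fixes f :: "real \<Rightarrow> real"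
  assumes "continuous_on UNIV f" "x \<le> y" "f x \<le> x \<and> y \<le> f y \<or> x \<le> f x \<and> f y \<le> y"
  shows "\<exists>z. x \<le> z \<and> z \<le> y \<and> f z = z"
proof -
  have cont: "continuous_on {x..y} (\<lambda>t. f t - t)"
    using assms(1) by (intro continuous_intros) (auto intro: continuous_on_subset)
  show ?thesis
    using IVT'[of "\<lambda>t. f t - t" x 0 y] IVT2'[of "\<lambda>t. f t - t" y 0 x] cont assms(2,3) by auto
qed

text \<open>
  All elements preserve orientation. They are continuous because a monotone surjection of the line is.
\<close>

locale line_group =
  fixes G :: "(real \<Rightarrow> real) set"
  assumes id_mem [simp]: "id \<in> G"
    and comp_mem [simp]: "f \<in> G \<Longrightarrow> g \<in> G \<Longrightarrow> f \<circ> g \<in> G"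
    and inverse_mem [simp]: "f \<in> G \<Longrightarrow> inverse_map f \<in> G"
    and mono_mem: "f \<in> G \<Longrightarrow> strict_mono f"
    and surj_mem: "f \<in> G \<Longrightarrow> surj f"
    and fixed_point_unique: "f \<in> G \<Longrightarrow> f x = x \<Longrightarrow> f y = y \<Longrightarrow> x \<noteq> y \<Longrightarrow> f = id"
begin

lemma inverse_left [simp]: "f \<in> G \<Longrightarrow> inverse_map f (f x) = x"
  using mono_mem strict_mono_imp_inj_on by (metis inv_f_f)

lemma inverse_right [simp]: "f \<in> G \<Longrightarrow> f (inverse_map f x) = x"
  using surj_mem by (simp add: surj_f_inv_f)

lemma less_iff [simp]: "f \<in> G \<Longrightarrow> f x < f y \<longleftrightarrow> x < y"
  and le_iff [simp]: "f \<in> G \<Longrightarrow> f x \<le> f y \<longleftrightarrow> x \<le> y"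
  and eq_iff [simp]: "f \<in> G \<Longrightarrow> f x = f y \<longleftrightarrow> x = y"
  using mono_mem by (auto simp: strict_mono_less strict_mono_less_eq strict_mono_eq)

lemma inverse_less_iff: "f \<in> G \<Longrightarrow> inverse_map f x < y \<longleftrightarrow> x < f y"
  using less_iff[of f "inverse_map f x" y] by simp

lemma less_inverse_iff: "f \<in> G \<Longrightarrow> x < inverse_map f y \<longleftrightarrow> f x < y"
  using less_iff[of f x "inverse_map f y"] by simp

lemma inverse_le_iff: "f \<in> G \<Longrightarrow> inverse_map f x \<le> y \<longleftrightarrow> x \<le> f y"
  using le_iff[of f "inverse_map f x" y] by simp

lemma le_inverse_iff: "f \<in> G \<Longrightarrow> x \<le> inverse_map f y \<longleftrightarrow> f x \<le> y"
  using le_iff[of f x "inverse_map f y"] by simp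

lemma inverse_eq_iff: "f \<in> G \<Longrightarrow> inverse_map f x = y \<longleftrightarrow> x = f y"
  by auto

lemma continuous_mem: "f \<in> G \<Longrightarrow> continuous_on UNIV f"
  by (intro mono_surj_continuous strict_mono_mono mono_mem surj_mem)

lemma funpow_mem [simp]: "f \<in> G \<Longrightarrow> f ^^ n \<in> G"
  by (induction n) simp_all

lemma comp_inverse: "f \<in> G \<Longrightarrow> f \<circ> inverse_map f = id" "f \<in> G \<Longrightarrow> inverse_map f \<circ> f = id"
  by auto

lemma inverse_comp_eq_id: "f \<in> G \<Longrightarrow> g \<in> G \<Longrightarrow> inverse_map f \<circ> g = id \<Longrightarrow> f = g"
  by (metis comp_apply ext id_apply inverse_right)

text \<open>
  On a ray without fixed points the sign of the displacement \<open>f y - y\<close> is constant.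
\<close>

lemma above_on_ray:
  assumes f: "f \<in> G" and free: "\<And>y. x \<le> y \<Longrightarrow> f y \<noteq> y" and y: "x \<le> y" "x \<le> z" "y < f y"
  shows "z < f z"
proof (rule ccontr)
  assume "\<not> z < f z"
  then have "\<exists>w. min y z \<le> w \<and> w \<le> max y z \<and> f w = w"
    using y by (intro fixed_point_between continuous_mem f) (auto simp: min_def max_def)
  then show False using free y by auto
qed

lemma below_on_ray:
  assumes f: "f \<in> G" and free: "\<And>y. x \<le> y \<Longrightarrow> f y \<noteq> y" and y: "x \<le> y" "x \<le> z" "f y < y"
  shows "f z < z"
proof (rule ccontr)
  assume "\<not> f z < z"
  then have "z < f z" using free[of z] y by (simp add: less_le)
  then show False using above_on_ray[OF f free y(2,1)] y(3) by simp
qed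

lemma eventually_free:
  assumes "f \<in> G" "f \<noteq> id"
  shows "\<exists>x. \<forall>y\<ge>x. f y \<noteq> y"
proof (cases "\<exists>p. f p = p")
  case True
  then obtain p where p: "f p = p" by blast
  have "f y \<noteq> y" if "p + 1 \<le> y" for y
    using fixed_point_unique[OF assms(1) p, of y] assms(2) that by auto
  then show ?thesis by blast
qed auto

lemma group_composition: "group (composition_monoid G)"
proof (rule groupI)
  fix f assume "f \<in> carrier (composition_monoid G)"
  then show "\<exists>g\<in>carrier (composition_monoid G). g \<otimes>\<^bsub>composition_monoid G\<^esub> f = \<one>\<^bsub>composition_monoid G\<^esub>"
    by (intro bexI[of _ "inverse_map f"]) (simp_all add: comp_inverse)
qed (simp_all add: comp_assoc)

text \<open>
  The map \<open>f\<^sup>-\<^sup>1 g\<close> has at most one fixed point unless \<open>f = g\<close>, so its displacement has a constant sign near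
  \<open>+\<infinity>\<close>.
\<close>

lemma germ_le_total:
  assumes f: "f \<in> G" and g: "g \<in> G"
  shows "germ_le f g \<or> germ_le g f"
proof (cases "f = g")
  case True then show ?thesis by (simp add: germ_le_def)
next
  case False
  define u where "u = inverse_map f \<circ> g"
  have u: "u \<in> G" "u \<noteq> id" using f g False inverse_comp_eq_id by (auto simp: u_def)
  then obtain x where x: "\<forall>y\<ge>x. u y \<noteq> y" using eventually_free by blast
  consider "x < u x" | "u x < x" using x by fastforce
  then show ?thesis
  proof cases
    case 1
    then have "\<forall>y\<ge>x. f y \<le> g y"
      using above_on_ray[OF u(1), of x x] x f by (auto simp: u_def less_inverse_iff intro: less_imp_le)
    then show ?thesis by (auto simp: germ_le_def eventually_at_top_linorder)
  next
    case 2
    then have "\<forall>y\<ge>x. g y \<le> f y"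
      using below_on_ray[OF u(1), of x x] x f by (auto simp: u_def inverse_less_iff intro: less_imp_le)
    then show ?thesis by (auto simp: germ_le_def eventually_at_top_linorder)
  qed
qed

sublocale biordered_group "composition_monoid G" germ_le
proof (intro biordered_group.intro group_composition biordered_group_axioms.intro; simp)
  fix f g assume f: "f \<in> G" and g: "g \<in> G"
  show "germ_le f g \<or> germ_le g f" by (rule germ_le_total[OF f g])
  show "f = g" if "germ_le f g" "germ_le g f"
  proof -
    have "\<forall>\<^sub>F x in at_top. f x = g x"
      using that unfolding germ_le_def by eventually_elim auto
    then obtain x where "\<forall>y\<ge>x. f y = g y" by (auto simp: eventually_at_top_linorder)
    then have "(inverse_map f \<circ> g) x = x" "(inverse_map f \<circ> g) (x + 1) = x + 1"
      using f by (auto simp: inverse_eq_iff)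
    then have "inverse_map f \<circ> g = id" using fixed_point_unique[of "inverse_map f \<circ> g" x "x + 1"] f g by simp
    then show ?thesis using inverse_comp_eq_id f g by blast
  qed
  fix h assume h: "h \<in> G"
  show "germ_le f h" if "germ_le f g" "germ_le g h"
    using that unfolding germ_le_def by eventually_elim auto
  show "germ_le (h \<circ> f) (h \<circ> g)" if "germ_le f g"
    using that unfolding germ_le_def by eventually_elim (use h in auto)
  show "germ_le (f \<circ> h) (g \<circ> h)" if le: "germ_le f g"
  proof -
    obtain x where "\<forall>y\<ge>x. f y \<le> g y"
      using le unfolding germ_le_def eventually_at_top_linorder by blast
    then have "\<forall>y\<ge>inverse_map h x. (f \<circ> h) y \<le> (g \<circ> h) y" using h by (auto simp: inverse_le_iff)
    then show ?thesis by (auto simp: germ_le_def eventually_at_top_linorder)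
  qed
qed

lemma inv_composition [simp]: "f \<in> G \<Longrightarrow> inv\<^bsub>composition_monoid G\<^esub> f = inverse_map f"
  by (rule inv_equality) (auto simp: comp_inverse)

text \<open>
  A finite limit of the iterates would be a fixed point.
\<close>

lemma iterates_unbounded_above:
  assumes f: "f \<in> G" and free: "\<And>y. x \<le> y \<Longrightarrow> f y \<noteq> y" and x: "x < f x"
  shows "\<exists>n. z < (f ^^ n) x"
proof (rule ccontr)
  assume "\<not> ?thesis"
  then have bdd: "\<forall>n. (f ^^ n) x \<le> z" by (auto simp: not_less)
  have ge: "x \<le> (f ^^ n) x" for n
  proof (induction n)
    case (Suc n)
    then have "f x \<le> f ((f ^^ n) x)" using f by simp
    then show ?case using x by simp
  qed simp
  have "(f ^^ n) x \<le> (f ^^ Suc n) x" for n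
    using above_on_ray[OF f free, of x x "(f ^^ n) x"] ge[of n] x by simp
  then have "incseq (\<lambda>n. (f ^^ n) x)" by (rule incseq_SucI)
  then obtain L where L: "(\<lambda>n. (f ^^ n) x) \<longlonglongrightarrow> L" using incseq_convergent bdd by blast
  have "isCont f L" using continuous_mem[OF f] by (simp add: continuous_on_eq_continuous_at)
  then have "(\<lambda>n. f ((f ^^ n) x)) \<longlonglongrightarrow> f L" using L by (rule isCont_tendsto_compose)
  moreover have "(\<lambda>n. f ((f ^^ n) x)) \<longlonglongrightarrow> L" using LIMSEQ_Suc[OF L] by simp
  ultimately have "f L = L" by (rule LIMSEQ_unique)
  moreover have "x \<le> L" using LIMSEQ_le_const[OF L] ge by blast
  ultimately show False using free by blast
qed

text \<open>
  Since \<open>h\<close> moves points of the ray to the right, some power of \<open>h\<close> exceeds \<open>g\<close> at the single point \<open>x\<close>.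
  Freeness on the ray spreads this inequality from \<open>x\<close> to all larger points.
\<close>

lemma dominating_if_free_on_ray:
  assumes free: "\<And>g y. g \<in> G \<Longrightarrow> g \<noteq> id \<Longrightarrow> x \<le> y \<Longrightarrow> g y \<noteq> y"
    and h: "h \<in> G" "germ_le id h" "h \<noteq> id"
  shows "dominating h"
proof -
  have "x < h x"
  proof (rule ccontr)
    assume "\<not> x < h x"
    then have "h x < x" using free[of h x] h by fastforce
    then have "\<forall>y\<ge>x. h y \<le> id y"
      using below_on_ray[OF h(1) free[OF h(1,3)], of x x] by (auto intro: less_imp_le)
    then have "germ_le h id" by (auto simp: germ_le_def eventually_at_top_linorder)
    then show False using h le_antisym[of h id] by simp
  qed
  have "\<exists>n. germ_le g (h ^^ n)" if g: "g \<in> G" for g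
  proof -
    obtain n where n: "g x < (h ^^ n) x"
      using iterates_unbounded_above[OF h(1) free[OF h(1,3)] \<open>x < h x\<close>] by blast
    define u where "u = inverse_map (h ^^ n) \<circ> g"
    have u: "u \<in> G" "u x < x" using h g n by (auto simp: u_def inverse_less_iff)
    then have "u \<noteq> id" by auto
    have "g y \<le> (h ^^ n) y" if "x \<le> y" for y
      using below_on_ray[OF u(1) free[OF u(1) \<open>u \<noteq> id\<close>] _ that u(2)] h by (simp add: u_def inverse_less_iff)
    then show ?thesis by (auto simp: germ_le_def eventually_at_top_linorder)
  qed
  then show ?thesis using h by (simp add: dominating_def)
qed

lemma commute_if_free_on_ray:
  assumes "\<And>g y. g \<in> G \<Longrightarrow> g \<noteq> id \<Longrightarrow> x \<le> y \<Longrightarrow> g y \<noteq> y" and "f \<in> G" "g \<in> G"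
  shows "f \<circ> g = g \<circ> f"
proof -
  have "dominating h" if "h \<in> G" "germ_le id h" "h \<noteq> id" for h
    by (rule dominating_if_free_on_ray[of x]) (use that assms(1) in auto)
  then show ?thesis using archimedean_commute[of f g] assms(2,3) by simp
qed

end

lemma (in line_group) iterates_unbounded_below:
  assumes f: "f \<in> G" and free: "\<And>y. y \<le> x \<Longrightarrow> f y \<noteq> y" and x: "f x < x"
  shows "\<exists>n. (f ^^ n) x < z"
proof (rule ccontr)
  assume "\<not> ?thesis"
  then have bdd: "\<forall>n. z \<le> (f ^^ n) x" by (auto simp: not_less)
  have below: "f y < y" if "y \<le> x" for y
  proof (rule ccontr)
    assume "\<not> f y < y"
    then have "\<exists>w. y \<le> w \<and> w \<le> x \<and> f w = w"
      using that x by (intro fixed_point_between continuous_mem f) auto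
    then show False using free by blast
  qed
  have le: "(f ^^ n) x \<le> x" for n
  proof (induction n)
    case (Suc n) then show ?case using below[of "(f ^^ n) x"] by simp
  qed simp
  have "(f ^^ Suc n) x \<le> (f ^^ n) x" for n
    using below[of "(f ^^ n) x"] le[of n] by simp
  then have "decseq (\<lambda>n. (f ^^ n) x)" by (rule decseq_SucI)
  then obtain L where L: "(\<lambda>n. (f ^^ n) x) \<longlonglongrightarrow> L" using decseq_convergent bdd by blast
  have "isCont f L" using continuous_mem[OF f] by (simp add: continuous_on_eq_continuous_at)
  then have "(\<lambda>n. f ((f ^^ n) x)) \<longlonglongrightarrow> f L" using L by (rule isCont_tendsto_compose)
  moreover have "(\<lambda>n. f ((f ^^ n) x)) \<longlonglongrightarrow> L" using LIMSEQ_Suc[OF L] by simp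
  ultimately have "f L = L" by (rule LIMSEQ_unique)
  moreover have "L \<le> x" using LIMSEQ_le_const2[OF L] le by blast
  ultimately show False using free by blast
qed

section \<open>Expanding elements\<close>

definition expanding :: "(real \<Rightarrow> real) \<Rightarrow> real \<Rightarrow> bool" where
  "expanding f q \<longleftrightarrow> f q = q \<and> (\<forall>x>q. x < f x) \<and> (\<forall>x<q. f x < x)"

locale nonabelian_line_group = line_group +
  assumes noncommuting: "\<exists>f\<in>G. \<exists>g\<in>G. f \<circ> g \<noteq> g \<circ> f"
begin

text \<open>
  Otherwise \<open>G\<close> acts freely and is commutative.
\<close>

lemma exists_fixed_point: "\<exists>f\<in>G. f \<noteq> id \<and> (\<exists>q. f q = q)"
  using noncommuting commute_if_free_on_ray[of 0] by metis

text \<open>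
  If all elements fixed \<open>q\<close>, the nontrivial ones would have no fixed points on the ray from \<open>q + 1\<close>, and
  \<open>G\<close> would be commutative.
\<close>

lemma no_global_fixed_point: "\<exists>g\<in>G. q < g q"
proof (rule ccontr)
  assume no: "\<not> ?thesis"
  have fix_q: "g q = q" if g: "g \<in> G" for g
  proof (rule antisym)
    show "g q \<le> q" using no g by force
    have "inverse_map g q \<le> q" using no inverse_mem[OF g] by force
    then show "q \<le> g q" using g by (simp add: inverse_le_iff)
  qed
  have "g y \<noteq> y" if "g \<in> G" "g \<noteq> id" "q + 1 \<le> y" for g y
    using fixed_point_unique[OF that(1) fix_q[OF that(1)], of y] that by auto
  then have "f \<circ> g = g \<circ> f" if "f \<in> G" "g \<in> G" for f g
    using commute_if_free_on_ray[of "q + 1"] that by blast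
  then show False using noncommuting by blast
qed

text \<open>
  A conjugate \<open>k\<close> of \<open>f\<close> fixes a point \<open>p\<close> to the right of \<open>q\<close> and moves all other points to the right. A high
  power of \<open>k\<close> is larger than \<open>f\<close> at \<open>p + 1\<close>, smaller at \<open>p\<close>, and not smaller at \<open>q\<close>. So the graphs of
  \<open>f\<close> and of this power meet in two points.
\<close>

lemma no_parabolic:
  assumes f: "f \<in> G" "f q = q" and above: "\<And>x. x \<noteq> q \<Longrightarrow> x < f x"
  shows False
proof -
  obtain g where g: "g \<in> G" "q < g q" using no_global_fixed_point by blast
  define p where "p = g q"
  define k where "k = g \<circ> f \<circ> inverse_map g"
  have k: "k \<in> G" "k p = p" using f g by (auto simp: k_def p_def)
  have k_above: "x < k x" if "x \<noteq> p" for x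
  proof -
    have "inverse_map g x \<noteq> q" using that g by (auto simp: p_def)
    then have "inverse_map g x < f (inverse_map g x)" by (rule above)
    then show ?thesis using g by (simp add: k_def inverse_less_iff)
  qed
  have k_free: "k y \<noteq> y" if "p + 1 \<le> y" for y using k_above[of y] that by auto
  obtain n where n: "f (p + 1) < (k ^^ n) (p + 1)"
    using iterates_unbounded_above[OF k(1) k_free k_above[of "p + 1"]] by auto
  define u where "u = inverse_map f \<circ> (k ^^ n)"
  have u: "u \<in> G" using f k by (simp add: u_def)
  have "q \<le> (k ^^ m) q" for m
  proof (induction m)
    case (Suc m)
    then show ?case using k_above[of "(k ^^ m) q"] k(2) by (cases "(k ^^ m) q = p") auto
  qed simp
  then have uq: "q \<le> u q" using f by (simp add: u_def le_inverse_iff)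
  have "(k ^^ m) p = p" for m using k(2) by (induction m) auto
  then have up: "u p < p" using f above[of p] g by (simp add: u_def p_def inverse_less_iff)
  have up1: "p + 1 < u (p + 1)" using f n by (simp add: u_def less_inverse_iff)
  obtain z where z: "q \<le> z" "z \<le> p" "u z = z"
    using fixed_point_between[OF continuous_mem[OF u], of q p] uq up g by (auto simp: p_def)
  obtain w where w: "p \<le> w" "w \<le> p + 1" "u w = w"
    using fixed_point_between[OF continuous_mem[OF u], of p "p + 1"] up up1 by auto
  have "z \<noteq> w" using z w up by auto
  then have "u = id" using fixed_point_unique[OF u z(3) w(3)] by blast
  then show False using up by simp
qed

lemma expanding_or_inverse_expanding:
  assumes f: "f \<in> G" "f \<noteq> id" "f q = q"
  shows "expanding f q \<or> expanding (inverse_map f) q"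
proof -
  have ne: "f x \<noteq> x" if "x \<noteq> q" for x using fixed_point_unique[OF f(1,3), of x] that f(2) by auto
  have same: "(x < f x) = (y < f y)" if "q < x \<and> q < y \<or> x < q \<and> y < q" for x y
  proof (rule ccontr)
    assume "(x < f x) \<noteq> (y < f y)"
    then have "\<exists>w. min x y \<le> w \<and> w \<le> max x y \<and> f w = w"
      by (intro fixed_point_between continuous_mem f) (auto simp: min_def max_def)
    then obtain w where "min x y \<le> w" "w \<le> max x y" "f w = w" by blast
    moreover from this have "w \<noteq> q" using that by (auto simp: min_def max_def split: if_splits)
    ultimately show False using ne by blast
  qed
  have inv_less: "inverse_map f x < x" if "x < f x" for x using that f(1) by (simp add: inverse_less_iff)
  have inv_greater: "x < inverse_map f x" if "f x < x" for x using that f(1) by (simp add: less_inverse_iff)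
  have inv_q: "inverse_map f q = q" using f by (simp add: inverse_eq_iff)
  have below: "f x < x" if "\<not> x < f x" "x \<noteq> q" for x using that ne[of x] by simp
  have right: "(\<forall>x>q. x < f x) \<or> (\<forall>x>q. f x < x)"
  proof (cases "q + 1 < f (q + 1)")
    case True
    then have "x < f x" if "q < x" for x using same[of x "q + 1"] that by simp
    then show ?thesis by blast
  next
    case False
    then have "\<not> x < f x" if "q < x" for x using same[of x "q + 1"] that by simp
    then show ?thesis using below by blast
  qed
  have left: "(\<forall>x<q. x < f x) \<or> (\<forall>x<q. f x < x)"
  proof (cases "q - 1 < f (q - 1)")
    case True
    then have "x < f x" if "x < q" for x using same[of x "q - 1"] that by simp
    then show ?thesis by blast
  next
    case False
    then have "\<not> x < f x" if "x < q" for x using same[of x "q - 1"] that by simp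
    then show ?thesis using below by blast
  qed
  consider "\<forall>x>q. x < f x" "\<forall>x<q. x < f x" | "\<forall>x>q. x < f x" "\<forall>x<q. f x < x"
    | "\<forall>x>q. f x < x" "\<forall>x<q. x < f x" | "\<forall>x>q. f x < x" "\<forall>x<q. f x < x"
    using left right by blast
  then show ?thesis
  proof cases
    case 1
    then have False using no_parabolic[OF f(1,3)] by (metis linorder_neqE_linordered_idom)
    then show ?thesis ..
  next
    case 2 then show ?thesis using f(3) by (simp add: expanding_def)
  next
    case 3 then show ?thesis using inv_q inv_less inv_greater by (simp add: expanding_def)
  next
    case 4
    then have "x < inverse_map f x" if "x \<noteq> q" for x
      using that inv_greater by (metis linorder_neqE_linordered_idom)
    then have False using no_parabolic[OF inverse_mem[OF f(1)] inv_q] by blast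
    then show ?thesis ..
  qed
qed

text \<open>
  If the graph of \<open>g\<close> passes below that of \<open>k\<close> once, it stays there up to \<open>+\<infinity>\<close>: the map \<open>k\<^sup>-\<^sup>1 g\<close> has a fixed
  point and moves some point towards it, so it is the inverse of an expanding element.
\<close>

lemma germ_le_if_crossing:
  assumes g: "g \<in> G" and k: "k \<in> G"
    and cross: "x < y" "k x \<le> g x \<and> g y < k y \<or> k x < g x \<and> g y \<le> k y"
  shows "germ_le g k"
proof -
  define u where "u = inverse_map k \<circ> g"
  have u: "u \<in> G" using g k by (simp add: u_def)
  have u_less: "u t < t \<longleftrightarrow> g t < k t" and u_le: "u t \<le> t \<longleftrightarrow> g t \<le> k t" for t
    using k by (simp_all add: u_def inverse_less_iff inverse_le_iff)
  have signs: "x \<le> u x \<and> u y < y \<or> x < u x \<and> u y \<le> y"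
    using cross(2) u_less u_le by (metis not_le)
  then have "u \<noteq> id" by auto
  obtain z where z: "x \<le> z" "z \<le> y" "u z = z"
    using fixed_point_between[OF continuous_mem[OF u], of x y] cross(1) signs by auto
  have "\<not> expanding u z"
  proof
    assume e: "expanding u z"
    have "x < u x \<Longrightarrow> x = z" using e z(1) unfolding expanding_def by (metis less_asym order_le_less)
    moreover have "u y < y \<Longrightarrow> y = z" using e z(2) unfolding expanding_def by (metis less_asym order_le_less)
    ultimately show False using signs z(3) by auto
  qed
  then have "expanding (inverse_map u) z"
    using expanding_or_inverse_expanding[OF u \<open>u \<noteq> id\<close> z(3)] by blast
  then have "u t < t" if "z < t" for t using that u by (simp add: expanding_def less_inverse_iff)
  then have "\<forall>t\<ge>z + 1. g t \<le> k t" using u_less by (auto intro: less_imp_le)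
  then show ?thesis unfolding germ_le_def eventually_at_top_linorder by blast
qed

text \<open>
  A crossing of \<open>g\<close> with a power of \<open>h\<close> can be found by varying the power on one side of \<open>q\<close>, where all powers
  agree: to the right of \<open>q\<close> if \<open>g\<close> moves \<open>q\<close> to the right or fixes it, to the left otherwise.
\<close>

lemma expanding_dominating:
  assumes h: "h \<in> G" "expanding h q"
  shows "dominating h"
proof -
  have e: "h q = q" "\<And>x. q < x \<Longrightarrow> x < h x" "\<And>x. x < q \<Longrightarrow> h x < x"
    using h(2) by (auto simp: expanding_def)
  have pow_q: "(h ^^ n) q = q" for n using e(1) by (induction n) auto
  have "\<exists>n. germ_le g (h ^^ n)" if g: "g \<in> G" for g
  proof (cases "q \<le> g q")
    case True
    have "h y \<noteq> y" if "q + 1 \<le> y" for y using e(2)[of y] that by auto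
    then obtain n where "g (q + 1) < (h ^^ n) (q + 1)"
      using iterates_unbounded_above[OF h(1), of "q + 1"] e(2)[of "q + 1"] by auto
    then show ?thesis
      using germ_le_if_crossing[OF g funpow_mem[OF h(1)], of q "q + 1" n] True pow_q by auto
  next
    case False
    have "h y \<noteq> y" if "y \<le> q - 1" for y using e(3)[of y] that by auto
    then obtain n where "(h ^^ n) (q - 1) < g (q - 1)"
      using iterates_unbounded_below[OF h(1), of "q - 1"] e(3)[of "q - 1"] by auto
    then show ?thesis
      using germ_le_if_crossing[OF g funpow_mem[OF h(1)], of "q - 1" q n] False pow_q by auto
  qed
  moreover have "germ_le id h"
    unfolding germ_le_def eventually_at_top_linorder
    using e(2) by (intro exI[of _ "q + 1"]) (auto intro: less_imp_le)
  moreover have "h \<noteq> id" using e(2)[of "q + 1"] by auto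
  ultimately show ?thesis using h(1) by (simp add: dominating_def)
qed

lemma exists_expanding: "\<exists>h\<in>G. \<exists>q. expanding h q"
  using exists_fixed_point expanding_or_inverse_expanding inverse_mem by metis

end

section \<open>Free actions and translation numbers\<close>

locale free_line_group = line_group T for T +
  assumes free: "t \<in> T \<Longrightarrow> t \<noteq> id \<Longrightarrow> t x \<noteq> x"
    and nontrivial: "\<exists>t\<in>T. t \<noteq> id"
begin

lemma less_everywhere:
  assumes s: "s \<in> T" and t: "t \<in> T" and "s x < t x"
  shows "s y < t y"
proof -
  define u where "u = inverse_map s \<circ> t"
  have u: "u \<in> T" "x < u x" using assms by (auto simp: u_def less_inverse_iff)
  then have "u \<noteq> id" by auto
  have "y < u y"
    using above_on_ray[OF u(1) free[OF u(1) \<open>u \<noteq> id\<close>], of "min x y" x y] u(2) by simp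
  then show ?thesis using s by (simp add: u_def less_inverse_iff)
qed

lemma positive_dominating:
  assumes t: "t \<in> T" "x < t x"
  shows "dominating t"
proof (rule dominating_if_free_on_ray[of 0])
  have "id y < t y" for y by (rule less_everywhere[of id t x]) (use t in auto)
  then show "germ_le id t" by (simp add: germ_le_def less_imp_le)
qed (use t free in auto)

lemma exists_translation_number:
  obtains \<phi> t0 where "monotone_hom \<phi>" "dominating t0" "\<phi> t0 = 1"
proof -
  obtain t where t: "t \<in> T" "t \<noteq> id" using nontrivial by blast
  have "0 < t 0 \<or> 0 < inverse_map t 0"
    using free[OF t, of 0] t(1) by (auto simp: less_inverse_iff neq_iff)
  then obtain t0 where "t0 \<in> T" "0 < t0 0" using t(1) inverse_mem by blast
  then have "dominating t0" by (rule positive_dominating)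
  then show ?thesis using hoelder_exists[of t0] that by blast
qed

text \<open>
  Every \<open>u\<close> in \<open>T\<close> that moves a point to the right dominates, so one of its powers exceeds \<open>t0\<close>, and
  \<open>\<phi> u\<close> is not merely nonnegative but positive.
\<close>

lemma translation_number_less_iff:
  assumes \<phi>: "monotone_hom \<phi>" "dominating t0" "\<phi> t0 = 1" and st: "s \<in> T" "t \<in> T"
  shows "s x < t x \<longleftrightarrow> \<phi> s < \<phi> t"
proof -
  have imp: "\<phi> s < \<phi> t" if st: "s \<in> T" "t \<in> T" and less: "s x < t x" for s t
  proof -
    define u where "u = inverse_map s \<circ> t"
    have u: "u \<in> T" "x < u x" using st less by (auto simp: u_def less_inverse_iff)
    then have "dominating u" by (rule positive_dominating)
    then obtain n where "germ_le t0 (u ^^ n)" using \<phi>(2) by (auto simp: dominating_def)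
    then have "1 \<le> n * \<phi> u"
      using monotone_hom_le[OF \<phi>(1), of t0 "u ^^ n"] monotone_hom_pow[OF \<phi>(1), of u n] u \<phi>
      by (simp add: dominating_def)
    then have "0 < \<phi> u" by (metis mult_nonneg_nonpos not_le of_nat_0_le_iff order_trans zero_less_one)
    moreover have "\<phi> u = \<phi> t - \<phi> s"
      using monotone_hom_mult[OF \<phi>(1), of "inverse_map s" t] monotone_hom_inv[OF \<phi>(1), of s] st
      by (simp add: u_def)
    ultimately show ?thesis by simp
  qed
  show ?thesis
  proof
    assume less: "\<phi> s < \<phi> t"
    show "s x < t x"
    proof (rule ccontr)
      assume "\<not> s x < t x"
      then consider "t x < s x" | "(inverse_map s \<circ> t) x = x" using st by (fastforce simp: inverse_eq_iff)
      then show False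
      proof cases
        case 1 then show False using imp[OF st(2,1)] less by simp
      next
        case 2
        then have "inverse_map s \<circ> t = id" using free[of "inverse_map s \<circ> t" x] st by auto
        then show False using inverse_comp_eq_id[OF st] less by simp
      qed
    qed
  qed (rule imp[OF st])
qed

end

section \<open>The translation subgroup\<close>

text \<open>
  \<open>T\<close> is the kernel of the homomorphism \<open>\<tau>\<close> belonging to the germ order and an expanding element. An element
  with a fixed point, or its inverse, is expanding and dominates, which forces \<open>\<tau>\<close> to be nonzero on it.
\<close>

lemma (in nonabelian_line_group) exists_free_normal_subgroup:
  obtains T where "T \<subseteq> G" "free_line_group T"
    "\<And>g t. g \<in> G \<Longrightarrow> t \<in> T \<Longrightarrow> g \<circ> t \<circ> inverse_map g \<in> T"
proof -
  obtain h q where h: "h \<in> G" "expanding h q" using exists_expanding by blast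
  obtain \<tau> where \<tau>: "monotone_hom \<tau>" "\<tau> h = 1"
    using hoelder_exists[OF expanding_dominating[OF h]] by blast
  have hom: "\<tau> (f \<circ> g) = \<tau> f + \<tau> g" if "f \<in> G" "g \<in> G" for f g
    using monotone_hom_mult[OF \<tau>(1), of f g] that by simp
  have hom_inv: "\<tau> (inverse_map f) = - \<tau> f" if "f \<in> G" for f
    using monotone_hom_inv[OF \<tau>(1), of f] that by simp
  have expanding_pos: "0 < \<tau> k" if k: "k \<in> G" "expanding k p" for k p
  proof -
    obtain n where "germ_le h (k ^^ n)"
      using expanding_dominating[OF k] h(1) by (auto simp: dominating_def)
    then have "1 \<le> n * \<tau> k"
      using monotone_hom_le[OF \<tau>(1), of h "k ^^ n"] monotone_hom_pow[OF \<tau>(1), of k n] h k \<tau> by simp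
    then show ?thesis by (metis mult_nonneg_nonpos not_le of_nat_0_le_iff order_trans zero_less_one)
  qed
  define T where "T = {f \<in> G. \<tau> f = 0}"
  have free: "t x \<noteq> x" if t: "t \<in> T" "t \<noteq> id" for t x
  proof
    assume "t x = x"
    then have "expanding t x \<or> expanding (inverse_map t) x"
      using expanding_or_inverse_expanding[of t x] t by (simp add: T_def)
    then have "0 < \<tau> t \<or> 0 < \<tau> (inverse_map t)" using expanding_pos[of t x] expanding_pos[of "inverse_map t" x] t
      by (auto simp: T_def)
    then show False using t hom_inv[of t] by (auto simp: T_def)
  qed
  obtain f g where fg: "f \<in> G" "g \<in> G" "f \<circ> g \<noteq> g \<circ> f" using noncommuting by blast
  have "\<exists>t\<in>T. t \<noteq> id"
  proof
    show "inverse_map (g \<circ> f) \<circ> (f \<circ> g) \<in> T" using fg by (simp add: T_def hom hom_inv)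
    show "inverse_map (g \<circ> f) \<circ> (f \<circ> g) \<noteq> id" using inverse_comp_eq_id[of "g \<circ> f" "f \<circ> g"] fg by auto
  qed
  moreover have "line_group T"
    using mono_mem surj_mem fixed_point_unique hom[of id id]
    by unfold_locales (auto simp: T_def hom hom_inv)
  ultimately have "free_line_group T"
    using free by (simp add: free_line_group_def free_line_group_axioms_def)
  moreover have "g \<circ> t \<circ> inverse_map g \<in> T" if "g \<in> G" "t \<in> T" for g t
    using that by (simp add: T_def hom hom_inv)
  ultimately show ?thesis using that[of T] by (auto simp: T_def)
qed

text \<open>
  The situation reached so far: \<open>T\<close> is a free normal subgroup with translation number \<open>\<phi>\<close>, measured in units of
  \<open>t0\<close>, and \<open>e\<close> is an expanding element whose fixed point \<open>q\<close> serves as the origin.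
\<close>

locale normal_translations = line_group G + transl: free_line_group T
  for G T +
  fixes \<phi> :: "(real \<Rightarrow> real) \<Rightarrow> real" and t0 e :: "real \<Rightarrow> real" and q :: real
  assumes translations_mem: "t \<in> T \<Longrightarrow> t \<in> G"
    and conj_mem: "g \<in> G \<Longrightarrow> t \<in> T \<Longrightarrow> g \<circ> t \<circ> inverse_map g \<in> T"
    and \<phi>_hom: "transl.monotone_hom \<phi>"
    and t0: "transl.dominating t0" "\<phi> t0 = 1"
    and e: "e \<in> G" "expanding e q"
begin

lemma t0_mem: "t0 \<in> T"
  using t0(1) by (simp add: transl.dominating_def)

lemma \<phi>_comp: "s \<in> T \<Longrightarrow> t \<in> T \<Longrightarrow> \<phi> (s \<circ> t) = \<phi> s + \<phi> t"
  using transl.monotone_hom_mult[OF \<phi>_hom] by simp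

lemma \<phi>_id: "\<phi> id = 0"
  using transl.monotone_hom_one[OF \<phi>_hom] by simp

lemma \<phi>_inverse: "t \<in> T \<Longrightarrow> \<phi> (inverse_map t) = - \<phi> t"
  using transl.monotone_hom_inv[OF \<phi>_hom, of t] by simp

lemma \<phi>_less_iff: "s \<in> T \<Longrightarrow> t \<in> T \<Longrightarrow> s x < t x \<longleftrightarrow> \<phi> s < \<phi> t"
  by (rule transl.translation_number_less_iff[OF \<phi>_hom t0])

lemma \<phi>_le_iff: "s \<in> T \<Longrightarrow> t \<in> T \<Longrightarrow> s x \<le> t x \<longleftrightarrow> \<phi> s \<le> \<phi> t"
  unfolding not_less[symmetric] using \<phi>_less_iff[of t s x] by blast

text \<open>
  The slope of the affine map that \<open>g\<close> will be conjugate to.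
\<close>

definition multiplier :: "(real \<Rightarrow> real) \<Rightarrow> real" where
  "multiplier g = \<phi> (g \<circ> t0 \<circ> inverse_map g)"

text \<open>
  Conjugation by \<open>g\<close> preserves the order of \<open>T\<close>, so \<open>\<phi>\<close> composed with it is another monotone homomorphism, and
  these are unique up to a factor.
\<close>

lemma \<phi>_conj:
  assumes g: "g \<in> G" and t: "t \<in> T"
  shows "\<phi> (g \<circ> t \<circ> inverse_map g) = multiplier g * \<phi> t"
proof -
  define \<psi> where "\<psi> s = \<phi> (g \<circ> s \<circ> inverse_map g)" for s
  have "\<psi> (s \<circ> r) = \<psi> s + \<psi> r" if "s \<in> T" "r \<in> T" for s r
  proof -
    have "g \<circ> (s \<circ> r) \<circ> inverse_map g = (g \<circ> s \<circ> inverse_map g) \<circ> (g \<circ> r \<circ> inverse_map g)"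
      using g by auto
    then show ?thesis using \<phi>_comp conj_mem[OF g] that by (simp add: \<psi>_def)
  qed
  moreover have "\<psi> s \<le> \<psi> r" if "s \<in> T" "r \<in> T" "germ_le s r" for s r
  proof -
    have "\<phi> s \<le> \<phi> r" using transl.monotone_hom_le[OF \<phi>_hom] that by simp
    then have "(g \<circ> s \<circ> inverse_map g) 0 \<le> (g \<circ> r \<circ> inverse_map g) 0"
      using \<phi>_le_iff[OF that(1,2)] g by simp
    then show ?thesis
      unfolding \<psi>_def by (rule iffD1[OF \<phi>_le_iff[OF conj_mem[OF g that(1)] conj_mem[OF g that(2)]]])
  qed
  ultimately have "transl.monotone_hom \<psi>" by (simp add: transl.monotone_hom_def)
  then show ?thesis
    using transl.hoelder_unique[OF t0(1) \<phi>_hom t0(2), of \<psi> t] t by (simp add: \<psi>_def multiplier_def)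
qed

lemma t0_above: "x < t0 x"
  using \<phi>_less_iff[of id t0 x] t0_mem t0(2) \<phi>_id by simp

lemma multiplier_pos:
  assumes g: "g \<in> G"
  shows "0 < multiplier g"
proof -
  have "id (g 0) < (g \<circ> t0 \<circ> inverse_map g) (g 0)" using g t0_above by simp
  then show ?thesis
    using \<phi>_less_iff[OF _ conj_mem[OF g t0_mem], of id] \<phi>_id by (simp add: multiplier_def)
qed

text \<open>
  As \<open>e\<close> fixes \<open>q\<close>, the conjugate \<open>e t0 e\<^sup>-\<^sup>1\<close> sends \<open>q\<close> to \<open>e (t0 q)\<close>, which lies to the right of \<open>t0 q\<close>.
\<close>

lemma multiplier_expanding: "1 < multiplier e"
proof -
  have "inverse_map e q = q" "t0 q < e (t0 q)"
    using e t0_above by (auto simp: expanding_def inverse_eq_iff)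
  then have "t0 q < (e \<circ> t0 \<circ> inverse_map e) q" by simp
  then show ?thesis
    using \<phi>_less_iff[OF t0_mem conj_mem[OF e(1) t0_mem]] t0(2) by (simp add: multiplier_def)
qed

lemma multiples:
  assumes s: "s \<in> T"
  shows "\<exists>t\<in>T. \<phi> t = of_int m * \<phi> s"
proof -
  have nat: "\<phi> (s ^^ n) = n * \<phi> s" for n
    using transl.monotone_hom_pow[OF \<phi>_hom, of s n] s by simp
  show ?thesis
  proof (cases "0 \<le> m")
    case True
    then show ?thesis using nat[of "nat m"] s by (intro bexI[of _ "s ^^ nat m"]) auto
  next
    case False
    then show ?thesis
      using nat[of "nat (- m)"] s \<phi>_inverse[of "s ^^ nat (- m)"]
      by (intro bexI[of _ "inverse_map (s ^^ nat (- m))"]) auto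
  qed
qed

text \<open>
  Conjugating \<open>t0\<close> by powers of \<open>e\<^sup>-\<^sup>1\<close> divides its translation number by powers of the multiplier of \<open>e\<close>.
\<close>

lemma small_translation:
  assumes "0 < \<epsilon>"
  shows "\<exists>s\<in>T. 0 < \<phi> s \<and> \<phi> s < \<epsilon>"
proof -
  have "\<exists>s\<in>T. \<phi> s = (1 / multiplier e) ^ n" for n
  proof (induction n)
    case 0 then show ?case using t0_mem t0(2) by auto
  next
    case (Suc n)
    then obtain s where s: "s \<in> T" "\<phi> s = (1 / multiplier e) ^ n" by blast
    let ?r = "inverse_map e \<circ> s \<circ> inverse_map (inverse_map e)"
    have r: "?r \<in> T" using conj_mem[OF inverse_mem[OF e(1)] s(1)] .
    have "e \<circ> ?r \<circ> inverse_map e = s"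
      using e(1) inverse_left[OF inverse_mem[OF e(1)]] by auto
    then have "\<phi> s = multiplier e * \<phi> ?r" using \<phi>_conj[OF e(1) r] by simp
    then have "\<phi> ?r = (1 / multiplier e) ^ Suc n" using s(2) multiplier_expanding by (simp add: field_simps)
    then show ?case using r by blast
  qed
  moreover obtain n where "(1 / multiplier e) ^ n < \<epsilon>"
    using real_arch_pow_inv[OF assms, of "1 / multiplier e"] multiplier_expanding by auto
  moreover have "0 < (1 / multiplier e) ^ n" using multiplier_expanding by simp
  ultimately show ?thesis by metis
qed

lemma \<phi>_dense:
  assumes "a < b"
  shows "\<exists>t\<in>T. a < \<phi> t \<and> \<phi> t < b"
proof -
  obtain s where s: "s \<in> T" "0 < \<phi> s" "\<phi> s < b - a" using small_translation[of "b - a"] assms by auto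
  obtain t where t: "t \<in> T" "\<phi> t = of_int (\<lfloor>a / \<phi> s\<rfloor> + 1) * \<phi> s" using multiples[OF s(1)] by blast
  have "a < (\<lfloor>a / \<phi> s\<rfloor> + 1) * \<phi> s" "\<lfloor>a / \<phi> s\<rfloor> * \<phi> s \<le> a"
    using floor_divide_upper[OF s(2)] floor_divide_lower[OF s(2)] by auto
  then have "a < \<phi> t \<and> \<phi> t < b" using t(2) s(3) by (simp add: algebra_simps)
  then show ?thesis using t(1) by blast
qed

section \<open>The semiconjugacy to an affine action\<close>

text \<open>
  The monotone extension of the map \<open>t q \<mapsto> \<phi> t\<close> from the orbit of \<open>q\<close> to the line.
\<close>

definition semiconj :: "real \<Rightarrow> real" where
  "semiconj x = Sup (\<phi> ` {t \<in> T. t q \<le> x})"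

lemma translation_below: "\<exists>t\<in>T. t q \<le> x"
proof -
  have t: "inverse_map t0 y < y" for y
    using t0_mem t0_above by (simp add: transl.inverse_less_iff)
  then have "inverse_map t0 y \<noteq> y" for y by (metis less_irrefl)
  then have "\<exists>n. (inverse_map t0 ^^ n) q < x"
    using t t0_mem by (intro transl.iterates_unbounded_below) auto
  then obtain n where "(inverse_map t0 ^^ n) q < x" ..
  then show ?thesis using t0_mem by (intro bexI[of _ "inverse_map t0 ^^ n"]) auto
qed

lemma translation_above: "\<exists>t\<in>T. x \<le> t q"
proof -
  have "t0 y \<noteq> y" for y using t0_above by (metis less_irrefl)
  then have "\<exists>n. x < (t0 ^^ n) q"
    using t0_above t0_mem by (intro transl.iterates_unbounded_above) auto
  then obtain n where "x < (t0 ^^ n) q" ..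
  then show ?thesis using t0_mem by (intro bexI[of _ "t0 ^^ n"]) auto
qed

lemma semiconj_bdd: "bdd_above (\<phi> ` {t \<in> T. t q \<le> x})"
proof -
  obtain s where s: "s \<in> T" "x \<le> s q" using translation_above by blast
  have "\<phi> t \<le> \<phi> s" if "t \<in> T" "t q \<le> x" for t using \<phi>_le_iff[of t s q] s that by simp
  then show ?thesis by (intro bdd_aboveI[of _ "\<phi> s"]) auto
qed

lemma semiconj_mono: "x \<le> y \<Longrightarrow> semiconj x \<le> semiconj y"
  unfolding semiconj_def using semiconj_bdd translation_below by (intro cSup_subset_mono image_mono) force+

lemma semiconj_orbit:
  assumes t: "t \<in> T"
  shows "semiconj (t q) = \<phi> t"
  unfolding semiconj_def using t \<phi>_le_iff by (intro cSup_eq_maximum) auto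

lemma semiconj_q: "semiconj q = 0"
  using semiconj_orbit[of id] \<phi>_id by simp

lemma le_if_\<phi>_less: "s \<in> T \<Longrightarrow> \<phi> s < semiconj x \<Longrightarrow> s q \<le> x"
  and le_if_less_\<phi>: "s \<in> T \<Longrightarrow> semiconj x < \<phi> s \<Longrightarrow> x \<le> s q"
  using semiconj_mono[of x "s q"] semiconj_mono[of "s q" x] semiconj_orbit[of s] by (auto intro: ccontr)

text \<open>
  Since \<open>\<phi>\<close> has dense image, an affine expression in \<open>semiconj x\<close> is determined by its values on the orbit
  points to the left and to the right of \<open>x\<close>.
\<close>

lemma semiconj_squeeze:
  assumes c: "0 < c"
    and lower: "\<And>s. s \<in> T \<Longrightarrow> s q \<le> x \<Longrightarrow> A + c * \<phi> s \<le> K"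
    and upper: "\<And>s. s \<in> T \<Longrightarrow> x \<le> s q \<Longrightarrow> K \<le> A + c * \<phi> s"
  shows "K = A + c * semiconj x"
proof (rule antisym)
  show "K \<le> A + c * semiconj x"
  proof (rule ccontr)
    assume "\<not> ?thesis"
    then have "semiconj x < (K - A) / c" using c by (simp add: field_simps)
    then obtain s where s: "s \<in> T" "semiconj x < \<phi> s" "\<phi> s < (K - A) / c" using \<phi>_dense by blast
    then show False using upper[OF s(1) le_if_less_\<phi>[OF s(1,2)]] c by (simp add: field_simps)
  qed
  show "A + c * semiconj x \<le> K"
  proof (rule ccontr)
    assume "\<not> ?thesis"
    then have "(K - A) / c < semiconj x" using c by (simp add: field_simps)
    then obtain s where s: "s \<in> T" "(K - A) / c < \<phi> s" "\<phi> s < semiconj x" using \<phi>_dense by blast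
    then show False using lower[OF s(1) le_if_\<phi>_less[OF s(1,3)]] c by (simp add: field_simps)
  qed
qed

lemma semiconj_translation:
  assumes t: "t \<in> T"
  shows "semiconj (t x) = \<phi> t + semiconj x"
proof -
  have "semiconj (t (s q)) = \<phi> t + \<phi> s" if "s \<in> T" for s
    using semiconj_orbit[of "t \<circ> s"] \<phi>_comp t that by simp
  then have "semiconj (t x) = \<phi> t + 1 * semiconj x"
    using t semiconj_mono by (intro semiconj_squeeze) (simp, metis mult_1 transl.le_iff, metis mult_1 transl.le_iff)
  then show ?thesis by simp
qed

text \<open>
  On the orbit, \<open>g (t q) = (g t g\<^sup>-\<^sup>1) (g q)\<close> is a translate of \<open>g q\<close> by an element whose translation number is
  \<open>multiplier g \<cdot> \<phi> t\<close>. The other points follow by squeezing.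
\<close>

theorem semiconj_affine:
  assumes g: "g \<in> G"
  shows "semiconj (g x) = semiconj (g q) + multiplier g * semiconj x"
proof (rule semiconj_squeeze[OF multiplier_pos[OF g]])
  have orbit: "semiconj (g (s q)) = semiconj (g q) + multiplier g * \<phi> s" if "s \<in> T" for s
    using semiconj_translation[OF conj_mem[OF g that], of "g q"] \<phi>_conj[OF g that] g by simp
  show "semiconj (g q) + multiplier g * \<phi> s \<le> semiconj (g x)" if "s \<in> T" "s q \<le> x" for s
    using orbit[OF that(1)] semiconj_mono[of "g (s q)" "g x"] that g by simp
  show "semiconj (g x) \<le> semiconj (g q) + multiplier g * \<phi> s" if "s \<in> T" "x \<le> s q" for s
    using orbit[OF that(1)] semiconj_mono[of "g x" "g (s q)"] that g by simp
qed

text \<open>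
  A monotone map with dense range that skipped a value \<open>y\<close> would jump across it; the jump would take place
  at the supremum of the orbit points with value below \<open>y\<close>.
\<close>

lemma semiconj_surj: "surj semiconj"
proof -
  have "\<exists>x. semiconj x = y" for y
  proof -
    let ?X = "(\<lambda>t. t q) ` {t \<in> T. \<phi> t < y}"
    have ne: "?X \<noteq> {}" using \<phi>_dense[of "y - 1" y] by auto
    have above: "t q \<le> s q" if "t \<in> T" "\<phi> t < y" "s \<in> T" "y < \<phi> s" for s t
      using \<phi>_le_iff[of t s q] that by simp
    obtain s where "s \<in> T" "y < \<phi> s" using \<phi>_dense[of y "y + 1"] by auto
    then have bdd: "bdd_above ?X" using above by (intro bdd_aboveI[of _ "s q"]) auto
    have "\<not> semiconj (Sup ?X) < y"
    proof
      assume "semiconj (Sup ?X) < y"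
      then obtain t where t: "t \<in> T" "semiconj (Sup ?X) < \<phi> t" "\<phi> t < y" using \<phi>_dense by blast
      then have "t q \<le> Sup ?X" using bdd by (intro cSup_upper) auto
      then show False using semiconj_mono[of "t q" "Sup ?X"] semiconj_orbit[OF t(1)] t(2) by simp
    qed
    moreover have "\<not> y < semiconj (Sup ?X)"
    proof
      assume "y < semiconj (Sup ?X)"
      then obtain s where s: "s \<in> T" "y < \<phi> s" "\<phi> s < semiconj (Sup ?X)" using \<phi>_dense by blast
      have "Sup ?X \<le> s q" using above s by (intro cSup_least[OF ne]) auto
      then show False using semiconj_mono[of "Sup ?X" "s q"] semiconj_orbit[OF s(1)] s(3) by simp
    qed
    ultimately show ?thesis by (metis linorder_neqE_linordered_idom)
  qed
  then show ?thesis by (metis surjI)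
qed

end

section \<open>Bounded distortion along disjoint intervals\<close>

text \<open>
  This is where two continuous derivatives enter: \<open>e'' / e'\<close> is bounded on compact intervals.
\<close>

lemma ln_deriv_lipschitz_on_compact:
  assumes e: "C2_map e" and pos: "\<And>x. 0 < deriv e x"
  shows "\<exists>\<kappa>\<ge>0. \<forall>u\<in>{p..q}. \<forall>v\<in>{p..q}. \<bar>ln (deriv e u) - ln (deriv e v)\<bar> \<le> \<kappa> * \<bar>u - v\<bar>"
proof -
  let ?D = "\<lambda>x. deriv (deriv e) x / deriv e x"
  have cont: "continuous_on UNIV (deriv e)"
    using C2_mapD(2)[OF e] by (auto intro!: DERIV_continuous_on intro: has_field_derivative_at_within)
  have ne: "\<forall>x. deriv e x \<noteq> 0" using pos by (metis less_irrefl)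
  have "continuous_on {p..q} ?D"
    by (rule continuous_on_subset[of UNIV])
      (use C2_mapD(3)[OF e] cont ne in \<open>auto intro!: continuous_on_divide\<close>)
  then have "bounded (?D ` {p..q})" by (intro compact_imp_bounded compact_continuous_image) auto
  then obtain \<kappa> where \<kappa>: "0 < \<kappa>" "\<And>x. x \<in> {p..q} \<Longrightarrow> \<bar>?D x\<bar> \<le> \<kappa>"
    by (auto simp: bounded_pos)
  have "((\<lambda>x. ln (deriv e x)) has_real_derivative 1 / deriv e x * deriv (deriv e) x) (at x)" for x
    by (rule DERIV_chain2[OF DERIV_ln_divide[OF pos] C2_mapD(2)[OF e]])
  then have "((\<lambda>x. ln (deriv e x)) has_real_derivative ?D x) (at x within {p..q})" for x
    using has_field_derivative_at_within[of "\<lambda>x. ln (deriv e x)"] by simp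
  then have "norm (ln (deriv e u) - ln (deriv e v)) \<le> \<kappa> * norm (u - v)"
    if "u \<in> {p..q}" "v \<in> {p..q}" for u v
    using that \<kappa> by (intro field_differentiable_bound[where S = "{p..q}" and f' = ?D]) auto
  then show ?thesis using \<kappa>(1) by (intro exI[of _ \<kappa>]) auto
qed

text \<open>
  Lebesgue measure adds up the lengths.
\<close>

lemma sum_length_disjoint_le:
  fixes l r :: "nat \<Rightarrow> real"
  assumes disj: "disjoint_family (\<lambda>i. {l i..r i})" and sub: "\<And>i. {l i..r i} \<subseteq> {A..B}"
    and le: "\<And>i. l i \<le> r i"
  shows "(\<Sum>i<n. r i - l i) \<le> B - A"
proof -
  have "(\<Sum>i<n. r i - l i) = (\<Sum>i<n. measure lborel {l i..r i})" using le by simp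
  also have "\<dots> = measure lborel (\<Union>i<n. {l i..r i})"
    using disj by (intro measure_finite_Union[symmetric])
      (auto simp: disjoint_family_on_def emeasure_lborel_Icc_eq)
  also have "\<dots> \<le> measure lborel {A..B}"
  proof (rule measure_mono_fmeasurable)
    show "(\<Union>i<n. {l i..r i}) \<subseteq> {A..B}" using sub by (intro UN_least)
    show "{A..B} \<in> fmeasurable lborel" by (simp add: fmeasurable_def emeasure_lborel_Icc_eq)
  qed auto
  also have "\<dots> = B - A" using sub[of 0] le[of 0] by (auto simp: subset_iff)
  finally show ?thesis .
qed

text \<open>
  The maps \<open>h n\<close> are composed from a finite set of maps, and the images of \<open>[a, b]\<close> are disjoint in a
  bounded region. Bounded distortion on \<open>[a, b]\<close> itself would follow from the summability of the
  lengths; the point is to extend it to an interval that is longer on the left.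
  
  Let \<open>D\<close> be the distortion produced by intervals of total length at most twice that of \<open>[A, B]\<close>, and choose
  \<open>\<delta> = (b - a) / D\<close>. By induction on \<open>n\<close>, the image of the flank \<open>[a - \<delta>, a]\<close> is not longer than the
  image of \<open>[a, b]\<close>: if this holds for all earlier indices, the images of \<open>[a - \<delta>, b]\<close> so far have at
  most twice the lengths of those of \<open>[a, b]\<close>, so the distortion is at most \<open>D\<close>, and the choice of \<open>\<delta>\<close>
  closes the induction.
\<close>

theorem denjoy_schwartz:
  fixes h E :: "nat \<Rightarrow> real \<Rightarrow> real"
  assumes fin: "finite (range E)" and C2: "\<And>n. C2_map (E n)" and pos: "\<And>n x. 0 < deriv (E n) x"
    and h0: "h 0 = id" and hS: "\<And>n. h (Suc n) = E n \<circ> h n"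
    and ab: "a < b" and in_AB: "\<And>n. {h n a..h n b} \<subseteq> {A..B}"
    and disj: "disjoint_family (\<lambda>n. {h n a..h n b})"
  shows "\<exists>\<delta>>0. \<forall>n. 2 * A - B \<le> h n (a - \<delta>)"
proof -
  \<comment> \<open>The flanks can leave \<open>[A, B]\<close> on the left, but by at most its length, so the
    Lipschitz bounds are needed on \<open>[A - S, B]\<close>.\<close>
  define S where "S = B - A"
  have "\<exists>\<kappa>\<ge>0. \<forall>u\<in>{A - S..B}. \<forall>v\<in>{A - S..B}. \<bar>ln (deriv e u) - ln (deriv e v)\<bar> \<le> \<kappa> * \<bar>u - v\<bar>"
    if "e \<in> range E" for e
    using that C2 pos by (auto intro!: ln_deriv_lipschitz_on_compact)
  then obtain \<kappa>0 where \<kappa>0: "\<And>e. e \<in> range E \<Longrightarrow> 0 \<le> \<kappa>0 e \<and>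
      (\<forall>u\<in>{A - S..B}. \<forall>v\<in>{A - S..B}. \<bar>ln (deriv e u) - ln (deriv e v)\<bar> \<le> \<kappa>0 e * \<bar>u - v\<bar>)"
    by metis
  define \<kappa> where "\<kappa> = Max (\<kappa>0 ` range E)"
  have max: "\<kappa>0 (E n) \<le> \<kappa>" for n
    unfolding \<kappa>_def using fin by (intro Max_ge) auto
  have \<kappa>: "\<bar>ln (deriv (E n) u) - ln (deriv (E n) v)\<bar> \<le> \<kappa> * \<bar>u - v\<bar>"
    if "u \<in> {A - S..B}" "v \<in> {A - S..B}" for n u v
  proof -
    have "\<bar>ln (deriv (E n) u) - ln (deriv (E n) v)\<bar> \<le> \<kappa>0 (E n) * \<bar>u - v\<bar>"
      using \<kappa>0[of "E n"] that by blast
    also have "\<dots> \<le> \<kappa> * \<bar>u - v\<bar>" using max by (intro mult_right_mono) auto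
    finally show ?thesis .
  qed
  have \<kappa>_nonneg: "0 \<le> \<kappa>" using \<kappa>0[of "E 0"] max[of 0] by auto
  define h' where "h' n x = (\<Prod>i<n. deriv (E i) (h i x))" for n x
  have h'_pos: "0 < h' n x" for n x
    using pos by (auto simp: h'_def intro: prod_pos)
  have deriv_h: "(h n has_real_derivative h' n x) (at x)" for n x
  proof (induction n)
    case 0 then show ?case by (simp add: h0 h'_def id_def)
  next
    case (Suc n)
    then show ?case
      unfolding hS h'_def prod.lessThan_Suc
      by (subst mult.commute) (rule DERIV_chain[OF C2_mapD(1)[OF C2]], simp add: h'_def)
  qed
  have mono: "h n x < h n y" if "x < y" for n x y
    using that deriv_h h'_pos by (meson DERIV_pos_imp_increasing)
  define len where "len n = h n b - h n a" for n
  have len_sum: "(\<Sum>i<n. len i) \<le> S" for n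
    unfolding len_def S_def using disj in_AB mono[OF ab]
    by (intro sum_length_disjoint_le) (auto intro: less_imp_le)
  have bounds: "A \<le> h n a" "h n b \<le> B" for n
    using in_AB[of n] mono[OF ab, of n] by (auto simp: subset_iff)
  have len_le: "len n \<le> S" for n
    using bounds[of n] by (simp add: len_def S_def)
  define D where "D = exp (2 * \<kappa> * S)"
  define \<delta> where "\<delta> = (b - a) / D"
  have \<delta>: "0 < \<delta>" using ab by (simp add: \<delta>_def D_def)
  have flank: "h n a - h n (a - \<delta>) \<le> len n" for n
  proof (induction n rule: less_induct)
    case (less n)
    have ratio: "h' n x \<le> D * h' n y" if x: "x \<in> {a - \<delta>..b}" and y: "y \<in> {a - \<delta>..b}" for x y
    proof -
      have ne: "deriv (E i) u \<noteq> 0" for i u using pos[of i u] by simp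
      have ln_h': "ln (h' n z) = (\<Sum>i<n. ln (deriv (E i) (h i z)))" for z
        unfolding h'_def by (rule ln_prod[OF finite_lessThan ne])
      have step: "ln (deriv (E i) (h i x)) - ln (deriv (E i) (h i y)) \<le> \<kappa> * (2 * len i)" if "i < n" for i
      proof -
        have range: "h i z \<in> {h i (a - \<delta>)..h i b}" if "z \<in> {a - \<delta>..b}" for z
          using that mono[of _ z i] mono[of z _ i] by (auto simp: le_less)
        have low: "h i (a - \<delta>) \<ge> h i a - len i" using less[OF that] by simp
        then have "{h i (a - \<delta>)..h i b} \<subseteq> {A - S..B}"
          using bounds[of i] len_le[of i] by auto
        then have "\<bar>ln (deriv (E i) (h i x)) - ln (deriv (E i) (h i y))\<bar> \<le> \<kappa> * \<bar>h i x - h i y\<bar>"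
          using \<kappa> range x y by blast
        moreover have "\<bar>h i x - h i y\<bar> \<le> 2 * len i"
          using range[OF x] range[OF y] low by (auto simp: len_def abs_le_iff)
        ultimately show ?thesis
          using mult_left_mono[of "\<bar>h i x - h i y\<bar>" "2 * len i" \<kappa>] \<kappa>_nonneg by linarith
      qed
      have "ln (h' n x) - ln (h' n y) \<le> (\<Sum>i<n. \<kappa> * (2 * len i))"
        unfolding ln_h' sum_subtractf[symmetric] using step by (intro sum_mono) auto
      also have "\<dots> = 2 * \<kappa> * (\<Sum>i<n. len i)" by (simp add: sum_distrib_left algebra_simps)
      also have "\<dots> \<le> 2 * \<kappa> * S" using len_sum \<kappa>_nonneg by (intro mult_left_mono) auto
      finally have "ln (h' n x) \<le> 2 * \<kappa> * S + ln (h' n y)" by simp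
      then have "exp (ln (h' n x)) \<le> exp (2 * \<kappa> * S + ln (h' n y))" by simp
      then show ?thesis using h'_pos by (simp add: exp_add D_def)
    qed
    \<comment> \<open>Both lengths are values of the derivative, by the mean value theorem; \<open>ratio\<close> compares them.\<close>
    obtain y where y: "a < y" "y < b" "h n b - h n a = (b - a) * h' n y"
      using MVT2[OF ab, of "h n" "h' n"] deriv_h by blast
    obtain x where x: "a - \<delta> < x" "x < a" "h n a - h n (a - \<delta>) = (a - (a - \<delta>)) * h' n x"
      using MVT2[of "a - \<delta>" a "h n" "h' n"] deriv_h \<delta> by force
    have "h n a - h n (a - \<delta>) = \<delta> * h' n x" using x by simp
    also have "\<dots> \<le> \<delta> * (D * h' n y)"
      using ratio[of x y] x y \<delta> by (intro mult_left_mono) auto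
    also have "\<dots> = len n" using y by (simp add: \<delta>_def D_def len_def)
    finally show ?case .
  qed
  have "2 * A - B \<le> h n (a - \<delta>)" for n
    using flank[of n] len_le[of n] bounds[of n] by (simp add: S_def)
  then show ?thesis using \<delta> by blast
qed

section \<open>Absence of wandering intervals\<close>

locale C2_normal_translations = normal_translations +
  assumes C2: "g \<in> G \<Longrightarrow> C2_map g" and deriv_pos: "g \<in> G \<Longrightarrow> 0 < deriv g x"
begin

lemma integer_translation: "\<exists>t\<in>T. \<phi> t = of_int m"
  using multiples[OF t0_mem, of m] t0(2) by simp

definition integer_shift :: "int \<Rightarrow> real \<Rightarrow> real" where
  "integer_shift m = (SOME t. t \<in> T \<and> \<phi> t = of_int m)"

lemma integer_shift: "integer_shift m \<in> T" "\<phi> (integer_shift m) = of_int m"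
  using someI_ex[of "\<lambda>t. t \<in> T \<and> \<phi> t = of_int m"] integer_translation[of m]
  by (auto simp: integer_shift_def)

text \<open>
  The whole fibre is needed, not just some interval inside it: its images are determined by their values
  under the semiconjugacy, which makes them equal or disjoint, and any enlargement changes its image.
\<close>

lemma semiconj_fibre:
  obtains a b where "\<And>x. semiconj x = c \<longleftrightarrow> a \<le> x \<and> x \<le> b"
proof -
  have cont: "continuous_on UNIV semiconj"
    by (rule mono_surj_continuous[OF monoI[OF semiconj_mono] semiconj_surj])
  let ?F = "semiconj -` {c}"
  have "?F \<noteq> {}" using surjD[OF semiconj_surj, of c] by fastforce
  moreover obtain l where l: "semiconj l = c - 1" using surjD[OF semiconj_surj, of "c - 1"] by metis
  moreover obtain u where u: "semiconj u = c + 1" using surjD[OF semiconj_surj, of "c + 1"] by metis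
  have "x \<in> {l..u}" if "semiconj x = c" for x
    using semiconj_mono[of x l] semiconj_mono[of u x] l u that by (auto intro: ccontr)
  then have "bounded ?F" by (intro bounded_subset[OF bounded_closed_interval, of _ l u]) auto
  moreover have "closed ?F" using cont by (intro continuous_closed_vimage) (auto simp: continuous_on_eq_continuous_at)
  ultimately have F: "compact ?F" "?F \<noteq> {}" by (auto simp: compact_eq_bounded_closed)
  obtain a where a: "semiconj a = c" "\<And>x. semiconj x = c \<Longrightarrow> a \<le> x"
    using compact_attains_inf[OF F] by (metis vimage_singleton_eq)
  obtain b where b: "semiconj b = c" "\<And>x. semiconj x = c \<Longrightarrow> x \<le> b"
    using compact_attains_sup[OF F] by (metis vimage_singleton_eq)
  have "semiconj x = c" if "a \<le> x" "x \<le> b" for x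
    using semiconj_mono[OF that(1)] semiconj_mono[OF that(2)] a(1) b(1) by simp
  then show ?thesis using that[of a b] a(2) b(2) by blast
qed

text \<open>
  The value \<open>cs n\<close> of the \<open>n\<close>-th image of the fibre follows the orbit of \<open>c\<close> under \<open>u \<mapsto> r u mod 1\<close>, so the
  integer translations that occur are bounded and only finitely many maps are composed.
\<close>

lemma fibre_trivial_in_unit_interval:
  assumes "x < y" and c: "semiconj x = c" "semiconj y = c" "0 \<le> c" "c < 1"
  shows False
proof -
  define r where "r = multiplier e"
  have r: "1 < r" using multiplier_expanding by (simp add: r_def)
  have H_e: "semiconj (e z) = r * semiconj z" for z
    using semiconj_affine[OF e(1), of z] e(2) semiconj_q by (simp add: r_def expanding_def)
  obtain a b where fibre: "\<And>z. semiconj z = c \<longleftrightarrow> a \<le> z \<and> z \<le> b" using semiconj_fibre by blast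
  have ab: "a < b" using fibre[of x] fibre[of y] assms by simp
  define cs where "cs = rec_nat c (\<lambda>_ u. frac (r * u))"
  have cs_0: "cs 0 = c" and cs_Suc: "cs (Suc n) = frac (r * cs n)" for n by (simp_all add: cs_def)
  have cs_range: "0 \<le> cs n" "cs n < 1" for n
    using c by (cases n; simp add: cs_0 cs_Suc frac_lt_1)+
  define E where "E n = integer_shift (- \<lfloor>r * cs n\<rfloor>) \<circ> e" for n
  define h where "h = rec_nat id (\<lambda>n f. E n \<circ> f)"
  have h_0: "h 0 = id" and h_Suc: "h (Suc n) = E n \<circ> h n" for n by (simp_all add: h_def)
  have E_mem: "E n \<in> G" for n
    unfolding E_def by (intro comp_mem translations_mem integer_shift e)
  have h_mem: "h n \<in> G" for n
    by (induction n) (simp_all only: h_0 h_Suc id_mem comp_mem E_mem)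
  have H_E: "semiconj (E n z) = r * semiconj z - \<lfloor>r * cs n\<rfloor>" for n z
    using semiconj_translation[OF integer_shift(1)] by (simp add: E_def integer_shift(2) H_e)
  have H_h: "semiconj (h n z) = r ^ n * (semiconj z - c) + cs n" for n z
  proof (induction n)
    case 0 then show ?case by (simp add: h_0 cs_0)
  next
    case (Suc n)
    have "semiconj (h (Suc n) z) = r * semiconj (h n z) - \<lfloor>r * cs n\<rfloor>" by (simp add: h_Suc H_E)
    also have "\<dots> = r ^ Suc n * (semiconj z - c) + cs (Suc n)"
      unfolding Suc by (simp add: cs_Suc frac_def algebra_simps)
    finally show ?case .
  qed
  have fibre_h: "semiconj z = cs n \<longleftrightarrow> h n a \<le> z \<and> z \<le> h n b" for n z
  proof -
    have "semiconj z = cs n \<longleftrightarrow> semiconj (inverse_map (h n) z) = c"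
      using H_h[of n "inverse_map (h n) z"] h_mem[of n] r by simp
    then show ?thesis
      using h_mem[of n] by (simp add: fibre le_inverse_iff inverse_le_iff)
  qed
  \<comment> \<open>The fibres over \<open>[0, 1)\<close> lie between the points \<open>A\<close> and \<open>B\<close> with values \<open>-1\<close> and \<open>1\<close>.\<close>
  define A where "A = integer_shift (- 1) q"
  define B where "B = integer_shift 1 q"
  have HA: "semiconj A = - 1" and HB: "semiconj B = 1"
    using semiconj_orbit[OF integer_shift(1)] by (simp_all add: A_def B_def integer_shift(2))
  have in_AB: "{h n a..h n b} \<subseteq> {A..B}" for n
  proof
    fix z assume "z \<in> {h n a..h n b}"
    then have "semiconj z = cs n" by (simp add: fibre_h)
    then show "z \<in> {A..B}"
      using semiconj_mono[of z A] semiconj_mono[of B z] HA HB cs_range[of n] by (auto intro: ccontr)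
  qed
  have disj: "disjoint_family (\<lambda>n. {h n a..h n b})"
    unfolding disjoint_family_on_def
  proof (intro ballI impI, rule ccontr)
    fix m n :: nat assume "m \<noteq> n" and "{h m a..h m b} \<inter> {h n a..h n b} \<noteq> {}"
    then obtain z where "z \<in> {h m a..h m b}" "z \<in> {h n a..h n b}" by blast
    then have "semiconj z = cs m" "semiconj z = cs n" by (simp_all only: fibre_h atLeastAtMost_iff)
    then have "cs m = cs n" by simp
    then have same: "h m a \<le> z \<and> z \<le> h m b \<longleftrightarrow> h n a \<le> z \<and> z \<le> h n b" for z
      using fibre_h[of z m] fibre_h[of z n] by simp
    \<comment> \<open>Images over the same value have the same end points, so the two maps agree at two points;
      their slopes \<open>r ^ m\<close> and \<open>r ^ n\<close> differ.\<close>
    have le: "h k a \<le> h k b" for k using ab h_mem by simp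
    have "h m a = h n a" "h m b = h n b"
      using same[of "h m a"] same[of "h m b"] same[of "h n a"] same[of "h n b"] le[of m] le[of n] by auto
    then have "(inverse_map (h m) \<circ> h n) a = a" "(inverse_map (h m) \<circ> h n) b = b"
      using h_mem by (auto simp: inverse_eq_iff)
    then have "inverse_map (h m) \<circ> h n = id"
      using fixed_point_unique[of "inverse_map (h m) \<circ> h n" a b] h_mem ab by simp
    then have "h m = h n" using inverse_comp_eq_id h_mem by blast
    obtain w where "semiconj w = c + 1" using surjD[OF semiconj_surj, of "c + 1"] by metis
    then have "r ^ m = r ^ n" using H_h[of m w] H_h[of n w] \<open>h m = h n\<close> \<open>cs m = cs n\<close> by simp
    then show False using r \<open>m \<noteq> n\<close> by (simp add: power_inject_exp)
  qed
  have "\<lfloor>r * cs n\<rfloor> \<in> {0..\<lfloor>r\<rfloor>}" for n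
    using cs_range[of n] r mult_left_mono[of "cs n" 1 r] by (auto intro: floor_mono)
  then have "range E \<subseteq> (\<lambda>k. integer_shift (- k) \<circ> e) ` {0..\<lfloor>r\<rfloor>}" by (auto simp: E_def)
  then have fin: "finite (range E)" by (rule finite_subset) simp
  obtain \<delta> where \<delta>: "0 < \<delta>" "\<And>n. 2 * A - B \<le> h n (a - \<delta>)"
    using denjoy_schwartz[OF fin C2[OF E_mem] deriv_pos[OF E_mem] h_0 h_Suc ab in_AB disj] by blast
  \<comment> \<open>The enlarged interval has an image of length \<open>\<eta> > 0\<close>, and \<open>h n\<close> stretches it by \<open>r ^ n\<close>.\<close>
  define \<eta> where "\<eta> = c - semiconj (a - \<delta>)"
  have "semiconj (a - \<delta>) \<le> c" using semiconj_mono[of "a - \<delta>" a] fibre[of a] \<delta>(1) ab by simp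
  moreover have "semiconj (a - \<delta>) \<noteq> c" using fibre[of "a - \<delta>"] \<delta>(1) by simp
  ultimately have \<eta>: "0 < \<eta>" by (simp add: \<eta>_def)
  obtain n where n: "(1 - semiconj (2 * A - B)) / \<eta> < r ^ n" using real_arch_pow[OF r] by blast
  have "semiconj (2 * A - B) \<le> semiconj (h n (a - \<delta>))" by (rule semiconj_mono[OF \<delta>(2)])
  also have "\<dots> = cs n - r ^ n * \<eta>" by (simp add: H_h \<eta>_def algebra_simps)
  finally have "r ^ n * \<eta> < 1 - semiconj (2 * A - B)" using cs_range[of n] by simp
  then show False using n \<eta> by (simp add: field_simps)
qed

text \<open>
  An integer translation moves a nontrivial fibre into the unit interval.
\<close>

theorem semiconj_strict_mono: "strict_mono semiconj"
proof (rule strict_monoI)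
  fix x y :: real assume "x < y"
  have "semiconj x \<noteq> semiconj y"
  proof
    assume eq: "semiconj x = semiconj y"
    define s where "s = integer_shift (- \<lfloor>semiconj x\<rfloor>)"
    have s: "s \<in> T" "semiconj (s z) = semiconj z - \<lfloor>semiconj x\<rfloor>" for z
      using semiconj_translation[OF integer_shift(1)] integer_shift by (simp_all add: s_def)
    have "s x < s y" using \<open>x < y\<close> s(1) by simp
    then show False
      by (rule fibre_trivial_in_unit_interval[of _ _ "frac (semiconj x)"])
        (use eq in \<open>simp_all add: s(2) frac_def[symmetric] frac_lt_1\<close>)
  qed
  then show "semiconj x < semiconj y" using semiconj_mono[of x y] \<open>x < y\<close> by simp
qed

end

section \<open>The conjugacy to an affine group\<close>

text \<open>
  The chain rule for \<open>f\<^sup>-\<^sup>1 f = id\<close>.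
\<close>

lemma C2_inverse_deriv_nonzero:
  assumes f: "C2_map f" and inv: "C2_map (inv_into UNIV f)" and "bij f"
  shows "deriv f x \<noteq> 0"
proof
  assume "deriv f x = 0"
  then have "((inv_into UNIV f \<circ> f) has_real_derivative deriv (inv_into UNIV f) (f x) * 0) (at x)"
    using DERIV_chain[OF C2_mapD(1)[OF inv] C2_mapD(1)[OF f]] by metis
  moreover have "inv_into UNIV f \<circ> f = id" using \<open>bij f\<close> by (simp add: bij_is_inj)
  ultimately have "((\<lambda>x. x) has_real_derivative 0) (at x)" by (simp add: id_def)
  then show False using DERIV_unique[OF _ DERIV_ident] by fastforce
qed

lemma strict_mono_C2_deriv_pos:
  assumes "C2_map f" "C2_map (inv_into UNIV f)" "bij f" "strict_mono f"
  shows "0 < deriv f x"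
proof -
  have "0 \<le> deriv f x"
    using assms(4) C2_mapD(1)[OF assms(1)]
    by (intro mono_on_imp_deriv_nonneg[of UNIV f]) (auto intro: strict_mono_mono)
  then show ?thesis using C2_inverse_deriv_nonzero[OF assms(1-3), of x] by simp
qed

theorem theorem1p5:
  fixes G :: "(real \<Rightarrow> real) set"
  assumes "subgroup G Diff2"
    and "\<forall>g\<in>G. orientation_preserving g"
    and "\<not> comm_group (Diff2\<lparr>carrier := G\<rparr>)"
    and "\<forall>g\<in>G. g \<noteq> id \<longrightarrow> (\<exists>\<^sub>\<le>\<^sub>1 x. g x = x)"
  shows "\<exists>h\<in>Homeo. {h \<circ> g \<circ> inv_into UNIV h | g. g \<in> G} \<subseteq> Aff"
proof -
  have G_sub: "bij g \<and> C2_map g \<and> C2_map (inv_into UNIV g)" if "g \<in> G" for g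
    using subgroup.mem_carrier[OF assms(1) that] by (simp add: Diff2_def)
  have G_comp: "f \<circ> g \<in> G" if "f \<in> G" "g \<in> G" for f g
    using subgroup.m_closed[OF assms(1) that] by (simp add: Diff2_def)
  have G_id: "id \<in> G" using subgroup.one_closed[OF assms(1)] by (simp add: Diff2_def)
  have G_inv: "inv_into UNIV g \<in> G" if g: "g \<in> G" for g
  proof -
    have "inv\<^bsub>Diff2\<^esub> g = inv_into UNIV g"
      using G_sub[OF g] bij_imp_bij_inv[of g]
      by (intro group.inv_equality[OF group_Diff2])
        (auto simp: Diff2_def inv_inv_eq bij_is_inj)
    then show ?thesis using subgroup.m_inv_closed[OF assms(1) g] by simp
  qed
  interpret line_group G
    using G_sub G_comp G_id G_inv assms(2,4)
    by unfold_locales (auto simp: orientation_preserving_def bij_is_surj Uniq_def)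
  have "\<exists>f\<in>G. \<exists>g\<in>G. f \<circ> g \<noteq> g \<circ> f"
  proof (rule ccontr)
    assume "\<not> ?thesis"
    then have "comm_group (composition_monoid G)"
      using group_composition by (intro group.group_comm_groupI) auto
    moreover have "composition_monoid G = Diff2\<lparr>carrier := G\<rparr>"
      by (simp add: composition_monoid_def Diff2_def)
    ultimately show False using assms(3) by simp
  qed
  then interpret nonabelian_line_group G by unfold_locales
  obtain T where T: "T \<subseteq> G" "free_line_group T"
    "\<And>g t. g \<in> G \<Longrightarrow> t \<in> T \<Longrightarrow> g \<circ> t \<circ> inverse_map g \<in> T"
    using exists_free_normal_subgroup by blast
  interpret transl: free_line_group T by (rule T(2))
  obtain \<phi> t0 where \<phi>: "transl.monotone_hom \<phi>" "transl.dominating t0" "\<phi> t0 = 1"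
    using transl.exists_translation_number by blast
  obtain e q where e: "e \<in> G" "expanding e q" using exists_expanding by blast
  interpret C2_normal_translations G T \<phi> t0 e q
    using T \<phi> e G_sub mono_mem by unfold_locales (auto intro: strict_mono_C2_deriv_pos)
  have bij_H: "bij semiconj" using semiconj_strict_mono semiconj_surj by (simp add: bij_def strict_mono_imp_inj_on)
  have H_inv: "semiconj (inv_into UNIV semiconj y) = y" for y using semiconj_surj by (simp add: surj_f_inv_f)
  have "mono (inv_into UNIV semiconj)"
    by (rule monoI) (metis H_inv semiconj_strict_mono strict_mono_less_eq)
  then have "continuous_on UNIV (inv_into UNIV semiconj)"
    using bij_imp_bij_inv[OF bij_H] by (intro mono_surj_continuous) (auto simp: bij_def)
  moreover have "continuous_on UNIV semiconj"
    using semiconj_surj by (intro mono_surj_continuous) (auto intro: monoI semiconj_mono)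
  ultimately have "semiconj \<in> Homeo"
    using bij_H H_inv by (auto simp: Homeo_def bij_is_inj intro!: homeomorphismI)
  moreover have "semiconj \<circ> g \<circ> inv_into UNIV semiconj \<in> Aff" if g: "g \<in> G" for g
  proof -
    have "semiconj \<circ> g \<circ> inv_into UNIV semiconj = (\<lambda>y. multiplier g * y + semiconj (g q))"
    proof
      show "(semiconj \<circ> g \<circ> inv_into UNIV semiconj) y = multiplier g * y + semiconj (g q)" for y
        using semiconj_affine[OF g, of "inv_into UNIV semiconj y"] H_inv[of y] by simp
    qed
    moreover have "multiplier g \<noteq> 0" using multiplier_pos[OF g] by simp
    ultimately show ?thesis unfolding Aff_def by blast
  qed
  ultimately show ?thesis by blast
qed

end
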